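(* Let $w\in\{l,c\}$. Consider an $\mathcal{F}_2$-category $\mathcal{A}_\tau\to\mathcal{A}_\lambda\to\mathcal{A}_\phi$ over a 2-category $\mathcal{B}$, i.e. a commutative triangle of $\mathcal{F}$-functors $H_{\tau,\lambda}=H_{\tau,\phi}\,j$, where $j:\mathbb{A}_{\tau,\lambda}\to\mathbb{A}_{\tau,\phi}$ is the inclusion, $H_{\tau,\lambda}:\mathbb{A}_{\tau,\lambda}\to\mathcal{B}$ and $H_{\tau,\phi}:\mathbb{A}_{\tau,\phi}\to\mathcal{B}$, with common tight part $H_\tau:\mathcal{A}_\tau\to\mathcal{B}$. Suppose that $H_\tau$ admits a left (2-)adjoint, with induced 2-monad $T$ on $\mathcal{B}$ and Eilenberg–Moore comparison 2-functor $E:\mathcal{A}_\tau\to\text{T-Alg}_s$, that $\mathbb{A}_{\tau,\lambda}$ admits $\bar p$-limits (that is, pseudolimits) of loose morphisms and that $\mathbb{A}_{\tau,\phi}$ admits $\bar w$-limits of loose morphisms, so that $E$ extends uniquely to $\mathcal{F}$-functors $E_p:\mathbb{A}_{\tau,\lambda}\to\text{T-}\mathbb{A}\text{lg}_p$ and $E_w:\mathbb{A}_{\tau,\phi}\to\text{T-}\mathbb{A}\text{lg}_w$ over the base $\mathcal{B}$ (i.e. $E_p$ and $E_w$ are the unique $\mathcal{F}$-functors which agree with $E$ on tight parts and commute with the given and forgetful $\mathcal{F}$-functors to $\mathcal{B}$). Then the square $$\begin{array}{ccc}\mathbb{A}_{\tau,\lambda}&\xrightarrow{\ j\ }&\mathbb{A}_{\tau,\phi}\\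 {\scriptstyle E_p}\downarrow&&\downarrow{\scriptstyle E_w}\\ \text{T-}\mathbb{A}\text{lg}_p&\xrightarrow{\ j\ }&\text{T-}\mathbb{A}\text{lg}_w\end{array}$$ commutes, where the lower $j$ is the inclusion viewing pseudo morphisms as $w$-morphisms.
   Context: **$\mathcal{F}$-categories.** An $\mathcal{F}$-category $\mathbb{A}$ is a pair of 2-categories $\mathcal{A}_\tau,\mathcal{A}_\lambda$ with a 2-functor $j:\mathcal{A}_\tau\to\mathcal{A}_\lambda$ that is the identity on objects, faithful (injective on 1-cells) and locally fully faithful. The 1-cells of $\mathcal{A}_\lambda$ are the loose morphisms (written $A\rightsquigarrow B$); those coming from $\mathcal{A}_\tau$ are the tight morphisms (written $A\to B$). An $\mathcal{F}$-functor $F:\mathbb{A}\to\mathbb{B}$ is a 2-functor $F_\lambda:\mathcal{A}_\lambda\to\mathcal{B}_\lambda$ taking tight morphisms to tight morphisms; $F_\tau:\mathcal{A}_\tau\to\mathcal{B}_\tau$ is its restriction. A 2-category is viewed as an $\mathcal{F}$-category in which all morphisms are tight. $\mathbb{A}^{co}$ is obtained by reversing 2-cells. **$\mathcal{F}_2$-categories.** An $\mathcal{F}_2$-category is a composable pair of 2-functors $\mathcal{A}_\tau\to\mathcal{A}_\lambda\to\mathcal{A}_\phi$, each the identity on objects, faithful and locally fully faithful (tight, loose and very loose morphisms). Its $\mathcal{F}$-category $\mathbb{A}_{\tau,\lambda}$ is given by $\mathcal{A}_\tau\to\mathcal{A}_\lambda$ and $\mathbb{A}_{\tau,\phi}$ by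 $\mathcal{A}_\tau\to\mathcal{A}_\phi$; there is an inclusion $\mathcal{F}$-functor $j:\mathbb{A}_{\tau,\lambda}\to\mathbb{A}_{\tau,\phi}$, the identity on tight parts and $\mathcal{A}_\lambda\to\mathcal{A}_\phi$ on loose parts. "Loose morphisms of $\mathbb{A}_{\tau,\phi}$" are thus the morphisms of $\mathcal{A}_\phi$. **Limits of loose morphisms.** Put $\bar{l}=c$, $\bar{p}=p$, $\bar{c}=l$. The colax limit ($c$-limit) of a loose $f:A\rightsquigarrow B$ consists of an object $C_f$, tight morphisms $p_f:C_f\to A$, $q_f:C_f\to B$ and a 2-cell $\lambda_f:q_f\Rightarrow fp_f$ such that: (1) for every colax cone $(r:X\rightsquigarrow A,\ \alpha:s\Rightarrow fr,\ s:X\rightsquigarrow B)$ there is a unique $t:X\rightsquigarrow C_f$ with $p_ft=r$, $q_ft=s$, $\lambda_ft=\alpha$; (2) given colax cones $(r,\alpha,s)$, $(r',\alpha',s')$ from $X$, with induced $t,t'$, and 2-cells $\theta_r:r\Rightarrow r'$, $\theta_s:s\Rightarrow s'$ with $\alpha'\circ\theta_s=(f\theta_r)\circ\alpha$, there is a unique 2-cell $\phi:t\Rightarrow t'$ with $p_f\phi=\theta_r$, $q_f\phi=\theta_s$; (3) $t:X\rightsquigarrow C_f$ is tight just when $p_ft$ and $q_ft$ are tight. The pseudolimit ($p$-limit) is defined in the same way with $\lambda_f$ and the 2-cells $\alpha$ of all cones required invertible. The lax limit ($l$-limit) of $f$ in $\mathbb{A}$ is the colax limit of $f$ in $\mathbb{A}^{co}$.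 **Algebras.** Let $T=(T,\mu,\eta)$ be a 2-monad on a 2-category $\mathcal{B}$. Algebras are strict $T$-algebras $(A,a:TA\to A)$. A lax morphism $(f,\bar f):(A,a)\rightsquigarrow(B,b)$ is $f:A\to B$ with a 2-cell $\bar f:b\,Tf\Rightarrow fa$ satisfying $\bar f\mu_A=(\bar f\,Ta)\circ(b\,T\bar f)$ and $\bar f\eta_A=1_f$; it is a pseudo morphism if $\bar f$ is invertible and strict if $\bar f$ is an identity. A colax morphism has $\bar f:fa\Rightarrow b\,Tf$ satisfying the dual conditions. Pseudo morphisms are regarded as colax by inverting $\bar f$. An algebra 2-cell $\alpha:(f,\bar f)\Rightarrow(g,\bar g)$ of lax morphisms is a 2-cell $\alpha:f\Rightarrow g$ with $(\alpha a)\circ\bar f=\bar g\circ(b\,T\alpha)$; dually for colax. For $w=s,p,l,c$ (strict, pseudo, lax, colax) $\text{T-Alg}_w$ is the 2-category of algebras, $w$-morphisms and algebra 2-cells, with forgetful 2-functor $U_w:\text{T-Alg}_w\to\mathcal{B}$. For $w\in\{l,p,c\}$, $\text{T-}\mathbb{A}\text{lg}_w$ is the $\mathcal{F}$-category given by the inclusion $\text{T-Alg}_s\to\text{T-Alg}_w$ (tight = strict, loose = $w$-morphisms), with forgetful $\mathcal{F}$-functor to $\mathcal{B}$ having tight part $U_s$ and loose part $U_w$. The comparison $E$ satisfies $U_sE=H_\tau$. *)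

theory Defs
  imports Main
begin

section \<open>2-categories and 2-functors\<close>

record ('o, 'm, 'c) two_cat =
  Ob    :: "'o set"
  Arr   :: "'m set"
  Src   :: "'m \<Rightarrow> 'o"
  Trg   :: "'m \<Rightarrow> 'o"
  Id1   :: "'o \<Rightarrow> 'm"
  Comp1 :: "'m \<Rightarrow> 'm \<Rightarrow> 'm"  (infixr "\<odot>\<index>" 75)
  Cel   :: "'c set"
  Dom   :: "'c \<Rightarrow> 'm"
  Cod   :: "'c \<Rightarrow> 'm"
  Id2   :: "'m \<Rightarrow> 'c"
  Vcomp :: "'c \<Rightarrow> 'c \<Rightarrow> 'c"  (infixr "\<bullet>\<index>" 70)
  Hcomp :: "'c \<Rightarrow> 'c \<Rightarrow> 'c"  (infixr "\<star>\<index>" 75)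

text \<open>All compositions are written in applicative order: \<open>g \<odot> f\<close> is \<open>f\<close> followed by \<open>g\<close>,
  and likewise for the vertical (\<open>\<bullet>\<close>) and horizontal (\<open>\<star>\<close>) composites of 2-cells.\<close>

definition is_arr :: "('o, 'm, 'c) two_cat \<Rightarrow> 'm \<Rightarrow> 'o \<Rightarrow> 'o \<Rightarrow> bool" where
  "is_arr C f A B \<longleftrightarrow> f \<in> Arr C \<and> Src C f = A \<and> Trg C f = B"

definition is_cell :: "('o, 'm, 'c) two_cat \<Rightarrow> 'c \<Rightarrow> 'm \<Rightarrow> 'm \<Rightarrow> bool" where
  "is_cell C \<alpha> f g \<longleftrightarrow> \<alpha> \<in> Cel C \<and> Dom C \<alpha> = f \<and> Cod C \<alpha> = g"

abbreviation whisker_left :: "('o, 'm, 'c) two_cat \<Rightarrow> 'm \<Rightarrow> 'c \<Rightarrow> 'c"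
    ("_ \<lhd>\<index> _" [76, 75] 75) where
  "f \<lhd>\<^bsub>C\<^esub> \<alpha> \<equiv> Id2 C f \<star>\<^bsub>C\<^esub> \<alpha>"

abbreviation whisker_right :: "('o, 'm, 'c) two_cat \<Rightarrow> 'c \<Rightarrow> 'm \<Rightarrow> 'c"
    ("_ \<rhd>\<index> _" [76, 75] 75) where
  "\<alpha> \<rhd>\<^bsub>C\<^esub> f \<equiv> \<alpha> \<star>\<^bsub>C\<^esub> Id2 C f"

locale two_category =
  fixes C :: "('o, 'm, 'c) two_cat" (structure)
  assumes src_ob: "f \<in> Arr C \<Longrightarrow> Src C f \<in> Ob C"
    and trg_ob: "f \<in> Arr C \<Longrightarrow> Trg C f \<in> Ob C"
    and id1_arr: "A \<in> Ob C \<Longrightarrow> is_arr C (Id1 C A) A A"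
    and comp1_arr: "is_arr C f X Y \<Longrightarrow> is_arr C g Y Z \<Longrightarrow> is_arr C (g \<odot> f) X Z"
    and comp1_id_right: "is_arr C f X Y \<Longrightarrow> f \<odot> Id1 C X = f"
    and comp1_id_left: "is_arr C f X Y \<Longrightarrow> Id1 C Y \<odot> f = f"
    and comp1_assoc: "is_arr C f W X \<Longrightarrow> is_arr C g X Y \<Longrightarrow> is_arr C h Y Z \<Longrightarrow>
          (h \<odot> g) \<odot> f = h \<odot> (g \<odot> f)"
    and dom_arr: "\<alpha> \<in> Cel C \<Longrightarrow> Dom C \<alpha> \<in> Arr C"
    and cod_arr: "\<alpha> \<in> Cel C \<Longrightarrow> Cod C \<alpha> \<in> Arr C"
    and cell_src: "\<alpha> \<in> Cel C \<Longrightarrow> Src C (Dom C \<alpha>) = Src C (Cod C \<alpha>)"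
    and cell_trg: "\<alpha> \<in> Cel C \<Longrightarrow> Trg C (Dom C \<alpha>) = Trg C (Cod C \<alpha>)"
    and id2_cell: "f \<in> Arr C \<Longrightarrow> is_cell C (Id2 C f) f f"
    and vcomp_cell: "is_cell C \<alpha> f g \<Longrightarrow> is_cell C \<beta> g h \<Longrightarrow> is_cell C (\<beta> \<bullet> \<alpha>) f h"
    and vcomp_id_right: "is_cell C \<alpha> f g \<Longrightarrow> \<alpha> \<bullet> Id2 C f = \<alpha>"
    and vcomp_id_left: "is_cell C \<alpha> f g \<Longrightarrow> Id2 C g \<bullet> \<alpha> = \<alpha>"
    and vcomp_assoc: "is_cell C \<alpha> f g \<Longrightarrow> is_cell C \<beta> g h \<Longrightarrow> is_cell C \<gamma> h k \<Longrightarrow>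
          (\<gamma> \<bullet> \<beta>) \<bullet> \<alpha> = \<gamma> \<bullet> (\<beta> \<bullet> \<alpha>)"
    and hcomp_cell: "is_cell C \<alpha> f f' \<Longrightarrow> is_cell C \<beta> g g' \<Longrightarrow> Trg C f = Src C g \<Longrightarrow>
          is_cell C (\<beta> \<star> \<alpha>) (g \<odot> f) (g' \<odot> f')"
    and hcomp_id2: "is_arr C f X Y \<Longrightarrow> is_arr C g Y Z \<Longrightarrow> Id2 C g \<star> Id2 C f = Id2 C (g \<odot> f)"
    and interchange: "is_cell C \<alpha> f f' \<Longrightarrow> is_cell C \<alpha>' f' f'' \<Longrightarrow>
          is_cell C \<beta> g g' \<Longrightarrow> is_cell C \<beta>' g' g'' \<Longrightarrow> Trg C f = Src C g \<Longrightarrow>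
          (\<beta>' \<bullet> \<beta>) \<star> (\<alpha>' \<bullet> \<alpha>) = (\<beta>' \<star> \<alpha>') \<bullet> (\<beta> \<star> \<alpha>)"
    and hcomp_id_right: "is_cell C \<alpha> f g \<Longrightarrow> \<alpha> \<star> Id2 C (Id1 C (Src C f)) = \<alpha>"
    and hcomp_id_left: "is_cell C \<alpha> f g \<Longrightarrow> Id2 C (Id1 C (Trg C f)) \<star> \<alpha> = \<alpha>"
    and hcomp_assoc: "is_cell C \<alpha> f f' \<Longrightarrow> is_cell C \<beta> g g' \<Longrightarrow> is_cell C \<gamma> h h' \<Longrightarrow>
          Trg C f = Src C g \<Longrightarrow> Trg C g = Src C h \<Longrightarrow>
          (\<gamma> \<star> \<beta>) \<star> \<alpha> = \<gamma> \<star> (\<beta> \<star> \<alpha>)"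

definition inverse_cells :: "('o, 'm, 'c) two_cat \<Rightarrow> 'c \<Rightarrow> 'c \<Rightarrow> bool" where
  "inverse_cells C \<alpha> \<beta> \<longleftrightarrow> \<alpha> \<in> Cel C \<and> is_cell C \<beta> (Cod C \<alpha>) (Dom C \<alpha>) \<and>
     \<beta> \<bullet>\<^bsub>C\<^esub> \<alpha> = Id2 C (Dom C \<alpha>) \<and> \<alpha> \<bullet>\<^bsub>C\<^esub> \<beta> = Id2 C (Cod C \<alpha>)"

definition iso_cells :: "('o, 'm, 'c) two_cat \<Rightarrow> 'c set" where
  "iso_cells C = {\<alpha>. \<exists>\<beta>. inverse_cells C \<alpha> \<beta>}"

definition inv_cell :: "('o, 'm, 'c) two_cat \<Rightarrow> 'c \<Rightarrow> 'c" where
  "inv_cell C \<alpha> = (THE \<beta>. inverse_cells C \<alpha> \<beta>)"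

definition co :: "('o, 'm, 'c) two_cat \<Rightarrow> ('o, 'm, 'c) two_cat" where
  "co C = C\<lparr>Dom := Cod C, Cod := Dom C, Vcomp := (\<lambda>\<beta> \<alpha>. \<alpha> \<bullet>\<^bsub>C\<^esub> \<beta>)\<rparr>"

record ('o, 'm, 'c, 'p, 'n, 'd) two_fun =
  Fob  :: "'o \<Rightarrow> 'p"
  Farr :: "'m \<Rightarrow> 'n"
  Fcel :: "'c \<Rightarrow> 'd"

definition two_functor ::
    "('o, 'm, 'c) two_cat \<Rightarrow> ('p, 'n, 'd) two_cat \<Rightarrow> ('o, 'm, 'c, 'p, 'n, 'd) two_fun \<Rightarrow> bool" where
  "two_functor A B F \<longleftrightarrow>
     (\<forall>X \<in> Ob A. Fob F X \<in> Ob B) \<and>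
     (\<forall>f X Y. is_arr A f X Y \<longrightarrow> is_arr B (Farr F f) (Fob F X) (Fob F Y)) \<and>
     (\<forall>\<alpha> f g. is_cell A \<alpha> f g \<longrightarrow> is_cell B (Fcel F \<alpha>) (Farr F f) (Farr F g)) \<and>
     (\<forall>X \<in> Ob A. Farr F (Id1 A X) = Id1 B (Fob F X)) \<and>
     (\<forall>f g X Y Z. is_arr A f X Y \<longrightarrow> is_arr A g Y Z \<longrightarrow>
        Farr F (g \<odot>\<^bsub>A\<^esub> f) = Farr F g \<odot>\<^bsub>B\<^esub> Farr F f) \<and>
     (\<forall>f \<in> Arr A. Fcel F (Id2 A f) = Id2 B (Farr F f)) \<and>
     (\<forall>\<alpha> \<beta> f g h. is_cell A \<alpha> f g \<longrightarrow> is_cell A \<beta> g h \<longrightarrow>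
        Fcel F (\<beta> \<bullet>\<^bsub>A\<^esub> \<alpha>) = Fcel F \<beta> \<bullet>\<^bsub>B\<^esub> Fcel F \<alpha>) \<and>
     (\<forall>\<alpha> \<beta> f f' g g'. is_cell A \<alpha> f f' \<longrightarrow> is_cell A \<beta> g g' \<longrightarrow> Trg A f = Src A g \<longrightarrow>
        Fcel F (\<beta> \<star>\<^bsub>A\<^esub> \<alpha>) = Fcel F \<beta> \<star>\<^bsub>B\<^esub> Fcel F \<alpha>)"

definition two_fun_id :: "('o, 'm, 'c, 'o, 'm, 'c) two_fun" where
  "two_fun_id = \<lparr>Fob = (\<lambda>X. X), Farr = (\<lambda>f. f), Fcel = (\<lambda>\<alpha>. \<alpha>)\<rparr>"

definition two_fun_comp ::
    "('p, 'n, 'd, 'q, 'k, 'e) two_fun \<Rightarrow> ('o, 'm, 'c, 'p, 'n, 'd) two_fun \<Rightarrow>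
     ('o, 'm, 'c, 'q, 'k, 'e) two_fun" (infixr "\<circ>\<^sub>2" 75) where
  "G \<circ>\<^sub>2 F = \<lparr>Fob = Fob G \<circ> Fob F, Farr = Farr G \<circ> Farr F, Fcel = Fcel G \<circ> Fcel F\<rparr>"

lemma two_functorD:
  assumes "two_functor A B F"
  shows "X \<in> Ob A \<Longrightarrow> Fob F X \<in> Ob B"
    and "is_arr A f X Y \<Longrightarrow> is_arr B (Farr F f) (Fob F X) (Fob F Y)"
    and "is_cell A \<alpha> f g \<Longrightarrow> is_cell B (Fcel F \<alpha>) (Farr F f) (Farr F g)"
    and "X \<in> Ob A \<Longrightarrow> Farr F (Id1 A X) = Id1 B (Fob F X)"
    and "is_arr A f X Y \<Longrightarrow> is_arr A g Y Z \<Longrightarrow> Farr F (g \<odot>\<^bsub>A\<^esub> f) = Farr F g \<odot>\<^bsub>B\<^esub> Farr F f"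
    and "f \<in> Arr A \<Longrightarrow> Fcel F (Id2 A f) = Id2 B (Farr F f)"
    and "is_cell A \<alpha> f g \<Longrightarrow> is_cell A \<beta> g h \<Longrightarrow>
        Fcel F (\<beta> \<bullet>\<^bsub>A\<^esub> \<alpha>) = Fcel F \<beta> \<bullet>\<^bsub>B\<^esub> Fcel F \<alpha>"
    and "is_cell A \<alpha> f f' \<Longrightarrow> is_cell A \<beta> g g' \<Longrightarrow> Trg A f = Src A g \<Longrightarrow>
        Fcel F (\<beta> \<star>\<^bsub>A\<^esub> \<alpha>) = Fcel F \<beta> \<star>\<^bsub>B\<^esub> Fcel F \<alpha>"
  using assms unfolding two_functor_def by meson+

lemma two_functor_comp:
  assumes F: "two_functor A B F" and G: "two_functor B C G" and "two_category A"
  shows "two_functor A C (G \<circ>\<^sub>2 F)"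
proof -
  interpret A: two_category A by fact
  note fd = two_functorD[OF F] and gd = two_functorD[OF G]
  have t: "Trg B (Farr F f) = Src B (Farr F g)" if "f \<in> Arr A" "g \<in> Arr A" "Trg A f = Src A g" for f g
    using fd(2)[of f "Src A f" "Trg A f"] fd(2)[of g "Src A g" "Trg A g"] that by (auto simp: is_arr_def)
  show ?thesis
    unfolding two_functor_def two_fun_comp_def
    apply (intro conjI)
           apply (simp add: fd(1) gd(1))
          apply (simp, meson fd(2) gd(2))
         apply (simp, meson fd(3) gd(3))
        apply (simp add: fd(1,4) gd(4))
       apply (simp, metis fd(2,5) gd(5))
      apply (simp, metis fd(2,6) gd(6) is_arr_def)
     apply (simp, metis fd(3,7) gd(7))
    apply (intro allI impI)
    subgoal for \<alpha> \<beta> f f' g g'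
      using A.dom_arr[of \<alpha>] A.dom_arr[of \<beta>] fd(3)[of \<alpha> f f'] fd(3)[of \<beta> g g'] fd(8)[of \<alpha> f f' \<beta> g g'] t[of f g]
        gd(8)[of "Fcel F \<alpha>" "Farr F f" "Farr F f'" "Fcel F \<beta>" "Farr F g" "Farr F g'"]
      by (auto simp: is_cell_def)
    done
qed

text \<open>The component maps are total functions on the underlying types; equality of
  2-functors out of \<open>A\<close> is therefore agreement on the cells of \<open>A\<close>.\<close>

definition two_fun_eq ::
    "('o, 'm, 'c) two_cat \<Rightarrow> ('o, 'm, 'c, 'p, 'n, 'd) two_fun \<Rightarrow>
     ('o, 'm, 'c, 'p, 'n, 'd) two_fun \<Rightarrow> bool" where
  "two_fun_eq A F G \<longleftrightarrow> (\<forall>X \<in> Ob A. Fob F X = Fob G X) \<and>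
     (\<forall>f \<in> Arr A. Farr F f = Farr G f) \<and> (\<forall>\<alpha> \<in> Cel A. Fcel F \<alpha> = Fcel G \<alpha>)"

definition two_nat ::
    "('o, 'm, 'c) two_cat \<Rightarrow> ('p, 'n, 'd) two_cat \<Rightarrow> ('o, 'm, 'c, 'p, 'n, 'd) two_fun \<Rightarrow>
     ('o, 'm, 'c, 'p, 'n, 'd) two_fun \<Rightarrow> ('o \<Rightarrow> 'n) \<Rightarrow> bool" where
  "two_nat A B F G \<tau> \<longleftrightarrow>
     (\<forall>X \<in> Ob A. is_arr B (\<tau> X) (Fob F X) (Fob G X)) \<and>
     (\<forall>f X Y. is_arr A f X Y \<longrightarrow> Farr G f \<odot>\<^bsub>B\<^esub> \<tau> X = \<tau> Y \<odot>\<^bsub>B\<^esub> Farr F f) \<and>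
     (\<forall>\<alpha> f g X Y. is_arr A f X Y \<longrightarrow> is_cell A \<alpha> f g \<longrightarrow>
        Fcel G \<alpha> \<rhd>\<^bsub>B\<^esub> \<tau> X = \<tau> Y \<lhd>\<^bsub>B\<^esub> Fcel F \<alpha>)"

text \<open>\<open>F : B \<rightarrow> A\<close> is left 2-adjoint to \<open>G : A \<rightarrow> B\<close> with unit \<open>\<eta>\<close> and counit \<open>\<epsilon>\<close>.\<close>

definition two_adjunction ::
    "('p, 'n, 'd) two_cat \<Rightarrow> ('o, 'm, 'c) two_cat \<Rightarrow>
     ('p, 'n, 'd, 'o, 'm, 'c) two_fun \<Rightarrow> ('o, 'm, 'c, 'p, 'n, 'd) two_fun \<Rightarrow>
     ('p \<Rightarrow> 'n) \<Rightarrow> ('o \<Rightarrow> 'm) \<Rightarrow> bool" where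
  "two_adjunction B A F G \<eta> \<epsilon> \<longleftrightarrow>
     two_functor B A F \<and> two_functor A B G \<and>
     two_nat B B two_fun_id (G \<circ>\<^sub>2 F) \<eta> \<and> two_nat A A (F \<circ>\<^sub>2 G) two_fun_id \<epsilon> \<and>
     (\<forall>X \<in> Ob B. \<epsilon> (Fob F X) \<odot>\<^bsub>A\<^esub> Farr F (\<eta> X) = Id1 A (Fob F X)) \<and>
     (\<forall>Y \<in> Ob A. Farr G (\<epsilon> Y) \<odot>\<^bsub>B\<^esub> \<eta> (Fob G Y) = Id1 B (Fob G Y))"


section \<open>F-categories\<close>

record ('o, 'm, 'c, 'n, 'd) F_cat =
  Tight :: "('o, 'm, 'c) two_cat"
  Loose :: "('o, 'n, 'd) two_cat"
  Incl  :: "('o, 'm, 'c, 'o, 'n, 'd) two_fun"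

definition F_inclusion ::
    "('o, 'm, 'c) two_cat \<Rightarrow> ('o, 'n, 'd) two_cat \<Rightarrow> ('o, 'm, 'c, 'o, 'n, 'd) two_fun \<Rightarrow> bool" where
  "F_inclusion S L j \<longleftrightarrow> two_functor S L j \<and>
     Ob S = Ob L \<and> (\<forall>X \<in> Ob S. Fob j X = X) \<and>
     inj_on (Farr j) (Arr S) \<and>
     (\<forall>f X Y g. is_arr S f X Y \<longrightarrow> is_arr S g X Y \<longrightarrow>
        bij_betw (Fcel j) {\<alpha>. is_cell S \<alpha> f g} {\<alpha>. is_cell L \<alpha> (Farr j f) (Farr j g)})"

definition F_category :: "('o, 'm, 'c, 'n, 'd) F_cat \<Rightarrow> bool" where
  "F_category A \<longleftrightarrow> two_category (Tight A) \<and> two_category (Loose A) \<and>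
     F_inclusion (Tight A) (Loose A) (Incl A)"

definition tight_arrs :: "('o, 'm, 'c, 'n, 'd) F_cat \<Rightarrow> 'n set" where
  "tight_arrs A = Farr (Incl A) ` Arr (Tight A)"

text \<open>An F-functor is its loose part, subject to preservation of tight morphisms.\<close>

definition F_functor ::
    "('o, 'm, 'c, 'n, 'd) F_cat \<Rightarrow> ('o', 'm', 'c', 'n', 'd') F_cat \<Rightarrow>
     ('o, 'n, 'd, 'o', 'n', 'd') two_fun \<Rightarrow> bool" where
  "F_functor A B F \<longleftrightarrow> two_functor (Loose A) (Loose B) F \<and>
     (\<forall>f \<in> tight_arrs A. Farr F f \<in> tight_arrs B)"

definition tight_part ::
    "('o, 'm, 'c, 'n, 'd) F_cat \<Rightarrow> ('o', 'm', 'c', 'n', 'd') F_cat \<Rightarrow>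
     ('o, 'n, 'd, 'o', 'n', 'd') two_fun \<Rightarrow> ('o, 'm, 'c, 'o', 'm', 'c') two_fun \<Rightarrow> bool" where
  "tight_part A B F G \<longleftrightarrow> two_functor (Tight A) (Tight B) G \<and>
     two_fun_eq (Tight A) (F \<circ>\<^sub>2 Incl A) (Incl B \<circ>\<^sub>2 G)"

definition all_tight :: "('o, 'm, 'c) two_cat \<Rightarrow> ('o, 'm, 'c, 'm, 'c) F_cat" where
  "all_tight B = \<lparr>Tight = B, Loose = B, Incl = two_fun_id\<rparr>"

definition F_co :: "('o, 'm, 'c, 'n, 'd) F_cat \<Rightarrow> ('o, 'm, 'c, 'n, 'd) F_cat" where
  "F_co A = \<lparr>Tight = co (Tight A), Loose = co (Loose A), Incl = Incl A\<rparr>"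

record ('o, 'm1, 'c1, 'm2, 'c2, 'm3, 'c3) F2_cat =
  TightP     :: "('o, 'm1, 'c1) two_cat"
  LooseP     :: "('o, 'm2, 'c2) two_cat"
  VeryLooseP :: "('o, 'm3, 'c3) two_cat"
  InclTL     :: "('o, 'm1, 'c1, 'o, 'm2, 'c2) two_fun"
  InclLV     :: "('o, 'm2, 'c2, 'o, 'm3, 'c3) two_fun"

definition F2_category :: "('o, 'm1, 'c1, 'm2, 'c2, 'm3, 'c3) F2_cat \<Rightarrow> bool" where
  "F2_category A \<longleftrightarrow>
     two_category (TightP A) \<and> two_category (LooseP A) \<and> two_category (VeryLooseP A) \<and>
     F_inclusion (TightP A) (LooseP A) (InclTL A) \<and>
     F_inclusion (LooseP A) (VeryLooseP A) (InclLV A)"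

definition F_tl :: "('o, 'm1, 'c1, 'm2, 'c2, 'm3, 'c3) F2_cat \<Rightarrow> ('o, 'm1, 'c1, 'm2, 'c2) F_cat" where
  "F_tl A = \<lparr>Tight = TightP A, Loose = LooseP A, Incl = InclTL A\<rparr>"

definition F_tv :: "('o, 'm1, 'c1, 'm2, 'c2, 'm3, 'c3) F2_cat \<Rightarrow> ('o, 'm1, 'c1, 'm3, 'c3) F_cat" where
  "F_tv A = \<lparr>Tight = TightP A, Loose = VeryLooseP A, Incl = InclLV A \<circ>\<^sub>2 InclTL A\<rparr>"

text \<open>With these conventions \<open>InclLV A\<close> is the (loose part of the) inclusion F-functor
  \<open>F_tl A \<rightarrow> F_tv A\<close>.\<close>


section \<open>Limits of loose morphisms\<close>

datatype flavour = Pseudo | Lax | Colax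

fun bar :: "flavour \<Rightarrow> flavour" where
  "bar Pseudo = Pseudo"
| "bar Lax = Colax"
| "bar Colax = Lax"

text \<open>\<open>K\<close> is the class of 2-cells admitted in cones: all 2-cells for colax limits, the invertible
  ones for pseudolimits.\<close>

definition cone ::
    "('o, 'm, 'c) two_cat \<Rightarrow> 'c set \<Rightarrow> 'm \<Rightarrow> 'o \<Rightarrow> 'm \<Rightarrow> 'c \<Rightarrow> 'm \<Rightarrow> bool" where
  "cone L K f X r \<alpha> s \<longleftrightarrow> is_arr L r X (Src L f) \<and> is_arr L s X (Trg L f) \<and>
     is_cell L \<alpha> s (f \<odot>\<^bsub>L\<^esub> r) \<and> \<alpha> \<in> K"

definition induces ::
    "('o, 'm, 'c) two_cat \<Rightarrow> 'o \<Rightarrow> 'm \<Rightarrow> 'c \<Rightarrow> 'm \<Rightarrow> 'o \<Rightarrow> 'm \<Rightarrow> 'c \<Rightarrow> 'm \<Rightarrow> 'm \<Rightarrow> bool" where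
  "induces L C p \<Lambda> q X r \<alpha> s t \<longleftrightarrow> is_arr L t X C \<and>
     p \<odot>\<^bsub>L\<^esub> t = r \<and> q \<odot>\<^bsub>L\<^esub> t = s \<and> \<Lambda> \<rhd>\<^bsub>L\<^esub> t = \<alpha>"

definition limit_wrt ::
    "('o, 'm, 'c, 'n, 'd) F_cat \<Rightarrow> 'd set \<Rightarrow> 'n \<Rightarrow> 'o \<Rightarrow> 'n \<Rightarrow> 'd \<Rightarrow> 'n \<Rightarrow> bool" where
  "limit_wrt A K f C p \<Lambda> q \<longleftrightarrow> (let L = Loose A in
     C \<in> Ob L \<and> p \<in> tight_arrs A \<and> q \<in> tight_arrs A \<and> cone L K f C p \<Lambda> q \<and>
     (\<forall>X r \<alpha> s. cone L K f X r \<alpha> s \<longrightarrow> (\<exists>!t. induces L C p \<Lambda> q X r \<alpha> s t)) \<and>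
     (\<forall>X r \<alpha> s t r' \<alpha>' s' t' \<theta>r \<theta>s.
        cone L K f X r \<alpha> s \<longrightarrow> induces L C p \<Lambda> q X r \<alpha> s t \<longrightarrow>
        cone L K f X r' \<alpha>' s' \<longrightarrow> induces L C p \<Lambda> q X r' \<alpha>' s' t' \<longrightarrow>
        is_cell L \<theta>r r r' \<longrightarrow> is_cell L \<theta>s s s' \<longrightarrow>
        \<alpha>' \<bullet>\<^bsub>L\<^esub> \<theta>s = (f \<lhd>\<^bsub>L\<^esub> \<theta>r) \<bullet>\<^bsub>L\<^esub> \<alpha> \<longrightarrow>
        (\<exists>!\<phi>. is_cell L \<phi> t t' \<and> p \<lhd>\<^bsub>L\<^esub> \<phi> = \<theta>r \<and> q \<lhd>\<^bsub>L\<^esub> \<phi> = \<theta>s)) \<and>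
     (\<forall>X t. is_arr L t X C \<longrightarrow>
        (t \<in> tight_arrs A \<longleftrightarrow> p \<odot>\<^bsub>L\<^esub> t \<in> tight_arrs A \<and> q \<odot>\<^bsub>L\<^esub> t \<in> tight_arrs A)))"

definition colax_limit where
  "colax_limit A f C p \<Lambda> q \<longleftrightarrow> limit_wrt A (Cel (Loose A)) f C p \<Lambda> q"

definition pseudo_limit where
  "pseudo_limit A f C p \<Lambda> q \<longleftrightarrow> limit_wrt A (iso_cells (Loose A)) f C p \<Lambda> q"

definition lax_limit where
  "lax_limit A f C p \<Lambda> q \<longleftrightarrow> colax_limit (F_co A) f C p \<Lambda> q"

fun limit_of :: "flavour \<Rightarrow> ('o, 'm, 'c, 'n, 'd) F_cat \<Rightarrow> 'n \<Rightarrow> 'o \<Rightarrow> 'n \<Rightarrow> 'd \<Rightarrow> 'n \<Rightarrow> bool" where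
  "limit_of Pseudo = pseudo_limit"
| "limit_of Lax = lax_limit"
| "limit_of Colax = colax_limit"

definition admits_limits :: "flavour \<Rightarrow> ('o, 'm, 'c, 'n, 'd) F_cat \<Rightarrow> bool" where
  "admits_limits w A \<longleftrightarrow> (\<forall>f \<in> Arr (Loose A). \<exists>C p \<Lambda> q. limit_of w A f C p \<Lambda> q)"


section \<open>2-monads and their algebras\<close>

record ('o, 'm, 'c) two_mnd =
  Fun  :: "('o, 'm, 'c, 'o, 'm, 'c) two_fun"
  Mult :: "'o \<Rightarrow> 'm"
  Unit :: "'o \<Rightarrow> 'm"

definition two_monad :: "('o, 'm, 'c) two_cat \<Rightarrow> ('o, 'm, 'c) two_mnd \<Rightarrow> bool" where
  "two_monad B T \<longleftrightarrow> two_functor B B (Fun T) \<and>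
     two_nat B B (Fun T \<circ>\<^sub>2 Fun T) (Fun T) (Mult T) \<and> two_nat B B two_fun_id (Fun T) (Unit T) \<and>
     (\<forall>X \<in> Ob B.
        Mult T X \<odot>\<^bsub>B\<^esub> Farr (Fun T) (Mult T X) = Mult T X \<odot>\<^bsub>B\<^esub> Mult T (Fob (Fun T) X) \<and>
        Mult T X \<odot>\<^bsub>B\<^esub> Farr (Fun T) (Unit T X) = Id1 B (Fob (Fun T) X) \<and>
        Mult T X \<odot>\<^bsub>B\<^esub> Unit T (Fob (Fun T) X) = Id1 B (Fob (Fun T) X))"

definition induced_monad ::
    "('p, 'n, 'd, 'o, 'm, 'c) two_fun \<Rightarrow> ('o, 'm, 'c, 'p, 'n, 'd) two_fun \<Rightarrow>
     ('p \<Rightarrow> 'n) \<Rightarrow> ('o \<Rightarrow> 'm) \<Rightarrow> ('p, 'n, 'd) two_mnd" where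
  "induced_monad F G \<eta> \<epsilon> =
     \<lparr>Fun = G \<circ>\<^sub>2 F, Mult = (\<lambda>X. Farr G (\<epsilon> (Fob F X))), Unit = \<eta>\<rparr>"

lemma induced_two_monad:
  assumes B: "two_category B" and A: "two_category A" and adj: "two_adjunction B A F G \<eta> \<epsilon>"
  shows "two_monad B (induced_monad F G \<eta> \<epsilon>)"
proof -
  interpret A: two_category A by fact
  interpret B: two_category B by fact
  have F: "two_functor B A F" and G: "two_functor A B G"
    and n: "two_nat B B two_fun_id (G \<circ>\<^sub>2 F) \<eta>" and e: "two_nat A A (F \<circ>\<^sub>2 G) two_fun_id \<epsilon>"
    and t1: "\<And>X. X \<in> Ob B \<Longrightarrow> \<epsilon> (Fob F X) \<odot>\<^bsub>A\<^esub> Farr F (\<eta> X) = Id1 A (Fob F X)"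
    and t2: "\<And>Y. Y \<in> Ob A \<Longrightarrow> Farr G (\<epsilon> Y) \<odot>\<^bsub>B\<^esub> \<eta> (Fob G Y) = Id1 B (Fob G Y)"
    using adj by (auto simp: two_adjunction_def)
  note fd = two_functorD[OF F] and gd = two_functorD[OF G]
  have e1: "X \<in> Ob A \<Longrightarrow> is_arr A (\<epsilon> X) (Fob F (Fob G X)) X" for X
    using e by (auto simp: two_nat_def two_fun_comp_def two_fun_id_def)
  have e2: "is_arr A f X Y \<Longrightarrow> f \<odot>\<^bsub>A\<^esub> \<epsilon> X = \<epsilon> Y \<odot>\<^bsub>A\<^esub> Farr F (Farr G f)" for f X Y
    using e by (auto simp: two_nat_def two_fun_comp_def two_fun_id_def)
  have e3: "is_arr A f X Y \<Longrightarrow> is_cell A \<alpha> f g \<Longrightarrow> \<alpha> \<rhd>\<^bsub>A\<^esub> \<epsilon> X = \<epsilon> Y \<lhd>\<^bsub>A\<^esub> Fcel F (Fcel G \<alpha>)" for f X Y \<alpha> g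
    using e by (simp add: two_nat_def two_fun_comp_def two_fun_id_def) 
  have n1: "X \<in> Ob B \<Longrightarrow> is_arr B (\<eta> X) X (Fob G (Fob F X))" for X
    using n by (auto simp: two_nat_def two_fun_comp_def two_fun_id_def)
  have T: "two_functor B B (G \<circ>\<^sub>2 F)" by (rule two_functor_comp[OF F G B])
  have obs: "is_arr B f X Y \<Longrightarrow> X \<in> Ob B \<and> Y \<in> Ob B" for f X Y
    using B.src_ob B.trg_ob by (auto simp: is_arr_def)
  have N: "two_nat B B ((G \<circ>\<^sub>2 F) \<circ>\<^sub>2 (G \<circ>\<^sub>2 F)) (G \<circ>\<^sub>2 F) (\<lambda>X. Farr G (\<epsilon> (Fob F X)))"
    unfolding two_nat_def
  proof (intro conjI ballI allI impI, goal_cases)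
    case (1 X) then show ?case by (simp add: two_fun_comp_def e1 fd(1) gd(2))
  next
    case (2 f X Y)
    note h = fd(2)[OF 2] 
    have "X \<in> Ob B" "Y \<in> Ob B" using obs 2 by auto
    then have hx: "Fob F X \<in> Ob A" "Fob F Y \<in> Ob A" using fd(1) by auto
    show ?case using e2[OF h] gd(5)[OF e1 h] gd(5)[OF fd(2)[OF gd(2)[OF h]] e1] hx
      by (simp add: two_fun_comp_def)
  next
    case (3 \<alpha> f g X Y)
    note h = fd(2)[OF 3(1)] and c = fd(3)[OF 3(2)]
    have "X \<in> Ob B" "Y \<in> Ob B" using obs 3 by auto
    then have hx: "Fob F X \<in> Ob A" "Fob F Y \<in> Ob A" using fd(1) by auto
    have i: "is_cell A (Id2 A (\<epsilon> (Fob F X))) (\<epsilon> (Fob F X)) (\<epsilon> (Fob F X))"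
       "is_cell A (Id2 A (\<epsilon> (Fob F Y))) (\<epsilon> (Fob F Y)) (\<epsilon> (Fob F Y))"
      using A.id2_cell e1 hx by (auto simp: is_arr_def)
    have id: "Fcel G (Id2 A (\<epsilon> (Fob F X))) = Id2 B (Farr G (\<epsilon> (Fob F X)))"
      "Fcel G (Id2 A (\<epsilon> (Fob F Y))) = Id2 B (Farr G (\<epsilon> (Fob F Y)))"
      using gd(6) e1 hx by (auto simp: is_arr_def)
    have "Trg A (\<epsilon> (Fob F X)) = Src A (Farr F f)" "Trg A (Farr F (Farr G (Farr F f))) = Src A (\<epsilon> (Fob F Y))"
      using e1 hx h fd(2)[OF gd(2)[OF h]] by (auto simp: is_arr_def)
    from gd(8)[OF i(1) c this(1)] gd(8)[OF fd(3)[OF gd(3)[OF c]] i(2) this(2)] e3[OF h c]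
    show ?case by (simp add: two_fun_comp_def id)
  qed
  have L: "Farr G (\<epsilon> (Fob F X)) \<odot>\<^bsub>B\<^esub> Farr (G \<circ>\<^sub>2 F) (Farr G (\<epsilon> (Fob F X))) = Farr G (\<epsilon> (Fob F X)) \<odot>\<^bsub>B\<^esub> Farr G (\<epsilon> (Fob F (Fob (G \<circ>\<^sub>2 F) X))) \<and>
     Farr G (\<epsilon> (Fob F X)) \<odot>\<^bsub>B\<^esub> Farr (G \<circ>\<^sub>2 F) (\<eta> X) = Id1 B (Fob (G \<circ>\<^sub>2 F) X) \<and>
     Farr G (\<epsilon> (Fob F X)) \<odot>\<^bsub>B\<^esub> \<eta> (Fob (G \<circ>\<^sub>2 F) X) = Id1 B (Fob (G \<circ>\<^sub>2 F) X)" if X: "X \<in> Ob B" for X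
  proof -
    let ?Y = "Fob F X"
    have Y: "?Y \<in> Ob A" using fd(1) X by auto
    note eY = e1[OF Y]
    have eZ: "is_arr A (\<epsilon> (Fob F (Fob G ?Y))) (Fob F (Fob G (Fob F (Fob G ?Y)))) (Fob F (Fob G ?Y))"
      using e1 Y fd(1) gd(1) by auto
    show ?thesis
      using e2[OF eY] gd(5)[OF fd(2)[OF gd(2)[OF eY]] eY] gd(5)[OF eZ eY] t1[OF X] t2[OF Y]
       gd(5)[OF fd(2)[OF n1[OF X]] eY] gd(4)[OF Y]
      by (simp add: two_fun_comp_def)
  qed
  show ?thesis unfolding two_monad_def induced_monad_def
    using T N L n by simp
qed

datatype ('o, 'm) alg = Alg (und: 'o) (act: 'm)

text \<open>A weak morphism carries its source and target algebras, its underlying 1-cell and its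
  structure 2-cell.\<close>

datatype ('o, 'm, 'c) alg_mor =
  AlgMor (msrc: "('o, 'm) alg") (mtrg: "('o, 'm) alg") (mmap: 'm) (mcel: 'c)

datatype ('o, 'm, 'c) alg_cel =
  AlgCel (cdom: "('o, 'm, 'c) alg_mor") (ccod: "('o, 'm, 'c) alg_mor") (ccel: 'c)

definition is_alg :: "('o, 'm, 'c) two_cat \<Rightarrow> ('o, 'm, 'c) two_mnd \<Rightarrow> ('o, 'm) alg \<Rightarrow> bool" where
  "is_alg B T x \<longleftrightarrow> (let A = und x; a = act x in
     A \<in> Ob B \<and> is_arr B a (Fob (Fun T) A) A \<and>
     a \<odot>\<^bsub>B\<^esub> Mult T A = a \<odot>\<^bsub>B\<^esub> Farr (Fun T) a \<and> a \<odot>\<^bsub>B\<^esub> Unit T A = Id1 B A)"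

definition lax_mor :: "('o, 'm, 'c) two_cat \<Rightarrow> ('o, 'm, 'c) two_mnd \<Rightarrow> ('o, 'm, 'c) alg_mor \<Rightarrow> bool" where
  "lax_mor B T m \<longleftrightarrow>
     (let A = und (msrc m); a = act (msrc m); b = act (mtrg m); f = mmap m; \<phi> = mcel m in
     is_alg B T (msrc m) \<and> is_alg B T (mtrg m) \<and> is_arr B f A (und (mtrg m)) \<and>
     is_cell B \<phi> (b \<odot>\<^bsub>B\<^esub> Farr (Fun T) f) (f \<odot>\<^bsub>B\<^esub> a) \<and>
     \<phi> \<rhd>\<^bsub>B\<^esub> Mult T A = (\<phi> \<rhd>\<^bsub>B\<^esub> Farr (Fun T) a) \<bullet>\<^bsub>B\<^esub> (b \<lhd>\<^bsub>B\<^esub> Fcel (Fun T) \<phi>) \<and>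
     \<phi> \<rhd>\<^bsub>B\<^esub> Unit T A = Id2 B f)"

definition colax_mor :: "('o, 'm, 'c) two_cat \<Rightarrow> ('o, 'm, 'c) two_mnd \<Rightarrow> ('o, 'm, 'c) alg_mor \<Rightarrow> bool" where
  "colax_mor B T m \<longleftrightarrow>
     (let A = und (msrc m); a = act (msrc m); b = act (mtrg m); f = mmap m; \<phi> = mcel m in
     is_alg B T (msrc m) \<and> is_alg B T (mtrg m) \<and> is_arr B f A (und (mtrg m)) \<and>
     is_cell B \<phi> (f \<odot>\<^bsub>B\<^esub> a) (b \<odot>\<^bsub>B\<^esub> Farr (Fun T) f) \<and>
     \<phi> \<rhd>\<^bsub>B\<^esub> Mult T A = (b \<lhd>\<^bsub>B\<^esub> Fcel (Fun T) \<phi>) \<bullet>\<^bsub>B\<^esub> (\<phi> \<rhd>\<^bsub>B\<^esub> Farr (Fun T) a) \<and>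
     \<phi> \<rhd>\<^bsub>B\<^esub> Unit T A = Id2 B f)"

definition pseudo_mor :: "('o, 'm, 'c) two_cat \<Rightarrow> ('o, 'm, 'c) two_mnd \<Rightarrow> ('o, 'm, 'c) alg_mor \<Rightarrow> bool" where
  "pseudo_mor B T m \<longleftrightarrow> lax_mor B T m \<and> mcel m \<in> iso_cells B"

definition strict_mor :: "('o, 'm, 'c) two_cat \<Rightarrow> ('o, 'm, 'c) two_mnd \<Rightarrow> ('o, 'm, 'c) alg_mor \<Rightarrow> bool" where
  "strict_mor B T m \<longleftrightarrow> lax_mor B T m \<and> mcel m \<in> Id2 B ` Arr B"

definition lax_comp ::
    "('o, 'm, 'c) two_cat \<Rightarrow> ('o, 'm, 'c) two_mnd \<Rightarrow> ('o, 'm, 'c) alg_mor \<Rightarrow> ('o, 'm, 'c) alg_mor \<Rightarrow>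
     ('o, 'm, 'c) alg_mor" where
  "lax_comp B T n m = AlgMor (msrc m) (mtrg n) (mmap n \<odot>\<^bsub>B\<^esub> mmap m)
     ((mmap n \<lhd>\<^bsub>B\<^esub> mcel m) \<bullet>\<^bsub>B\<^esub> (mcel n \<rhd>\<^bsub>B\<^esub> Farr (Fun T) (mmap m)))"

definition colax_comp ::
    "('o, 'm, 'c) two_cat \<Rightarrow> ('o, 'm, 'c) two_mnd \<Rightarrow> ('o, 'm, 'c) alg_mor \<Rightarrow> ('o, 'm, 'c) alg_mor \<Rightarrow>
     ('o, 'm, 'c) alg_mor" where
  "colax_comp B T n m = AlgMor (msrc m) (mtrg n) (mmap n \<odot>\<^bsub>B\<^esub> mmap m)
     ((mcel n \<rhd>\<^bsub>B\<^esub> Farr (Fun T) (mmap m)) \<bullet>\<^bsub>B\<^esub> (mmap n \<lhd>\<^bsub>B\<^esub> mcel m))"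

definition alg_cell_between ::
    "('o, 'm, 'c) two_cat \<Rightarrow> ('o, 'm, 'c) alg_mor \<Rightarrow> ('o, 'm, 'c) alg_mor \<Rightarrow> 'c \<Rightarrow> bool" where
  "alg_cell_between B m n \<alpha> \<longleftrightarrow>
     msrc m = msrc n \<and> mtrg m = mtrg n \<and> is_cell B \<alpha> (mmap m) (mmap n)"

definition lax_cell ::
    "('o, 'm, 'c) two_cat \<Rightarrow> ('o, 'm, 'c) two_mnd \<Rightarrow> ('o, 'm, 'c) alg_cel \<Rightarrow> bool" where
  "lax_cell B T x \<longleftrightarrow> (let m = cdom x; n = ccod x; \<alpha> = ccel x in
     alg_cell_between B m n \<alpha> \<and>
     (\<alpha> \<rhd>\<^bsub>B\<^esub> act (msrc m)) \<bullet>\<^bsub>B\<^esub> mcel m = mcel n \<bullet>\<^bsub>B\<^esub> (act (mtrg m) \<lhd>\<^bsub>B\<^esub> Fcel (Fun T) \<alpha>))"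

definition colax_cell ::
    "('o, 'm, 'c) two_cat \<Rightarrow> ('o, 'm, 'c) two_mnd \<Rightarrow> ('o, 'm, 'c) alg_cel \<Rightarrow> bool" where
  "colax_cell B T x \<longleftrightarrow> (let m = cdom x; n = ccod x; \<alpha> = ccel x in
     alg_cell_between B m n \<alpha> \<and>
     mcel n \<bullet>\<^bsub>B\<^esub> (\<alpha> \<rhd>\<^bsub>B\<^esub> act (msrc m)) = (act (mtrg m) \<lhd>\<^bsub>B\<^esub> Fcel (Fun T) \<alpha>) \<bullet>\<^bsub>B\<^esub> mcel m)"

definition alg_two_cat ::
    "('o, 'm, 'c) two_cat \<Rightarrow> ('o, 'm, 'c) two_mnd \<Rightarrow> ('o, 'm, 'c) alg_mor set \<Rightarrow>
     (('o, 'm, 'c) alg_mor \<Rightarrow> ('o, 'm, 'c) alg_mor \<Rightarrow> ('o, 'm, 'c) alg_mor) \<Rightarrow>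
     ('o, 'm, 'c) alg_cel set \<Rightarrow>
     (('o, 'm) alg, ('o, 'm, 'c) alg_mor, ('o, 'm, 'c) alg_cel) two_cat" where
  "alg_two_cat B T M cmp S =
     \<lparr>Ob = {x. is_alg B T x}, Arr = M, Src = msrc, Trg = mtrg,
      Id1 = (\<lambda>x. AlgMor x x (Id1 B (und x)) (Id2 B (act x))), Comp1 = cmp,
      Cel = {x \<in> S. cdom x \<in> M \<and> ccod x \<in> M}, Dom = cdom, Cod = ccod,
      Id2 = (\<lambda>m. AlgCel m m (Id2 B (mmap m))),
      Vcomp = (\<lambda>y x. AlgCel (cdom x) (ccod y) (ccel y \<bullet>\<^bsub>B\<^esub> ccel x)),
      Hcomp = (\<lambda>y x. AlgCel (cmp (cdom y) (cdom x)) (cmp (ccod y) (ccod x)) (ccel y \<star>\<^bsub>B\<^esub> ccel x))\<rparr>"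

definition T_Alg_s where
  "T_Alg_s B T = alg_two_cat B T {m. strict_mor B T m} (lax_comp B T) {x. lax_cell B T x}"

fun T_Alg :: "flavour \<Rightarrow> ('o, 'm, 'c) two_cat \<Rightarrow> ('o, 'm, 'c) two_mnd \<Rightarrow>
     (('o, 'm) alg, ('o, 'm, 'c) alg_mor, ('o, 'm, 'c) alg_cel) two_cat" where
  "T_Alg Pseudo B T = alg_two_cat B T {m. pseudo_mor B T m} (lax_comp B T) {x. lax_cell B T x}"
| "T_Alg Lax B T = alg_two_cat B T {m. lax_mor B T m} (lax_comp B T) {x. lax_cell B T x}"
| "T_Alg Colax B T = alg_two_cat B T {m. colax_mor B T m} (colax_comp B T) {x. colax_cell B T x}"

text \<open>The inclusion of strict morphisms is the identity on data for every flavour, since an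
  identity structure 2-cell is its own inverse.\<close>

definition F_T_Alg where
  "F_T_Alg w B T = \<lparr>Tight = T_Alg_s B T, Loose = T_Alg w B T, Incl = two_fun_id\<rparr>"

definition forget ::
    "(('o, 'm) alg, ('o, 'm, 'c) alg_mor, ('o, 'm, 'c) alg_cel, 'o, 'm, 'c) two_fun" where
  "forget = \<lparr>Fob = und, Farr = mmap, Fcel = ccel\<rparr>"

definition inv_mor :: "('o, 'm, 'c) two_cat \<Rightarrow> ('o, 'm, 'c) alg_mor \<Rightarrow> ('o, 'm, 'c) alg_mor" where
  "inv_mor B m = AlgMor (msrc m) (mtrg m) (mmap m) (inv_cell B (mcel m))"

fun pseudo_incl :: "flavour \<Rightarrow> ('o, 'm, 'c) two_cat \<Rightarrow>
     (('o, 'm) alg, ('o, 'm, 'c) alg_mor, ('o, 'm, 'c) alg_cel,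
      ('o, 'm) alg, ('o, 'm, 'c) alg_mor, ('o, 'm, 'c) alg_cel) two_fun" where
  "pseudo_incl Pseudo B = two_fun_id"
| "pseudo_incl Lax B = two_fun_id"
| "pseudo_incl Colax B =
     \<lparr>Fob = (\<lambda>x. x), Farr = inv_mor B,
      Fcel = (\<lambda>x. AlgCel (inv_mor B (cdom x)) (inv_mor B (ccod x)) (ccel x))\<rparr>"

text \<open>The Eilenberg--Moore comparison \<open>A \<mapsto> (G A, G \<epsilon>\<^sub>A)\<close>, \<open>f \<mapsto> (G f, id)\<close>,
  \<open>\<alpha> \<mapsto> G \<alpha>\<close> for an adjunction with right adjoint \<open>G : A \<rightarrow> B\<close>.\<close>

definition comparison ::
    "('o, 'm, 'c) two_cat \<Rightarrow> ('p, 'n, 'd) two_cat \<Rightarrow> ('o, 'm, 'c, 'p, 'n, 'd) two_fun \<Rightarrow>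
     ('o \<Rightarrow> 'm) \<Rightarrow>
     ('o, 'm, 'c, ('p, 'n) alg, ('p, 'n, 'd) alg_mor, ('p, 'n, 'd) alg_cel) two_fun" where
  "comparison A B G \<epsilon> =
    (let eo = (\<lambda>X. Alg (Fob G X) (Farr G (\<epsilon> X)));
         ea = (\<lambda>f. AlgMor (eo (Src A f)) (eo (Trg A f)) (Farr G f)
                     (Id2 B (Farr G f \<odot>\<^bsub>B\<^esub> Farr G (\<epsilon> (Src A f)))))
     in \<lparr>Fob = eo, Farr = ea, Fcel = (\<lambda>\<alpha>. AlgCel (ea (Dom A \<alpha>)) (ea (Cod A \<alpha>)) (Fcel G \<alpha>))\<rparr>)"

lemma comparison_lands:
  assumes B: "two_category B" and A: "two_category A" and adj: "two_adjunction B A F G \<eta> \<epsilon>"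
  defines "T \<equiv> induced_monad F G \<eta> \<epsilon>"
  shows "X \<in> Ob A \<Longrightarrow> is_alg B T (Fob (comparison A B G \<epsilon>) X)"
   and "f \<in> Arr A \<Longrightarrow> strict_mor B T (Farr (comparison A B G \<epsilon>) f)"
   and "\<alpha> \<in> Cel A \<Longrightarrow> lax_cell B T (Fcel (comparison A B G \<epsilon>) \<alpha>)"
proof -
  interpret A: two_category A by fact
  interpret B: two_category B by fact
  have F: "two_functor B A F" and G: "two_functor A B G"
    and n: "two_nat B B two_fun_id (G \<circ>\<^sub>2 F) \<eta>" and e: "two_nat A A (F \<circ>\<^sub>2 G) two_fun_id \<epsilon>"
    and t1: "\<And>X. X \<in> Ob B \<Longrightarrow> \<epsilon> (Fob F X) \<odot>\<^bsub>A\<^esub> Farr F (\<eta> X) = Id1 A (Fob F X)"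
    and t2: "\<And>Y. Y \<in> Ob A \<Longrightarrow> Farr G (\<epsilon> Y) \<odot>\<^bsub>B\<^esub> \<eta> (Fob G Y) = Id1 B (Fob G Y)"
    using adj by (auto simp: two_adjunction_def)
  note fd = two_functorD[OF F] and gd = two_functorD[OF G]
  have e1: "X \<in> Ob A \<Longrightarrow> is_arr A (\<epsilon> X) (Fob F (Fob G X)) X" for X
    using e by (auto simp: two_nat_def two_fun_comp_def two_fun_id_def)
  have e2: "is_arr A f X Y \<Longrightarrow> f \<odot>\<^bsub>A\<^esub> \<epsilon> X = \<epsilon> Y \<odot>\<^bsub>A\<^esub> Farr F (Farr G f)" for f X Y
    using e by (auto simp: two_nat_def two_fun_comp_def two_fun_id_def)
  have e3: "is_arr A f X Y \<Longrightarrow> is_cell A \<alpha> f g \<Longrightarrow> \<alpha> \<rhd>\<^bsub>A\<^esub> \<epsilon> X = \<epsilon> Y \<lhd>\<^bsub>A\<^esub> Fcel F (Fcel G \<alpha>)" for f X Y \<alpha> g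
    using e by (simp add: two_nat_def two_fun_comp_def two_fun_id_def) 
  have n1: "X \<in> Ob B \<Longrightarrow> is_arr B (\<eta> X) X (Fob G (Fob F X))" for X
    using n by (auto simp: two_nat_def two_fun_comp_def two_fun_id_def)
  have TF: "Fob (Fun T) = (\<lambda>X. Fob G (Fob F X))" "Farr (Fun T) = (\<lambda>f. Farr G (Farr F f))"
     "Fcel (Fun T) = (\<lambda>f. Fcel G (Fcel F f))" "Mult T = (\<lambda>X. Farr G (\<epsilon> (Fob F X)))" "Unit T = \<eta>"
    by (auto simp: T_def induced_monad_def two_fun_comp_def)
  show al: "is_alg B T (Fob (comparison A B G \<epsilon>) X)" if X: "X \<in> Ob A" for X
  proof -
    note e = e1[OF X]
    have eZ: "is_arr A (\<epsilon> (Fob F (Fob G X))) (Fob F (Fob G (Fob F (Fob G X)))) (Fob F (Fob G X))"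
      using e1 X fd(1) gd(1) by auto
    show ?thesis using gd(2)[OF e] e2[OF e] gd(5)[OF fd(2)[OF gd(2)[OF e]] e] gd(5)[OF eZ e] t2[OF X] X gd(1)
      by (simp add: is_alg_def TF comparison_def)
  qed
  show st: "strict_mor B T (Farr (comparison A B G \<epsilon>) f)" if f: "f \<in> Arr A" for f
  proof -
    let ?X = "Src A f" and ?Y = "Trg A f"
    have h: "is_arr A f ?X ?Y" using f by (simp add: is_arr_def)
    have X: "?X \<in> Ob A" and Y: "?Y \<in> Ob A" using A.src_ob A.trg_ob f by auto
    note gf = gd(2)[OF h] and ge = gd(2)[OF e1[OF X]] and gy = gd(2)[OF e1[OF Y]]
    let ?h = "Farr G f \<odot>\<^bsub>B\<^esub> Farr G (\<epsilon> ?X)"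
    have eq: "Farr G (\<epsilon> ?Y) \<odot>\<^bsub>B\<^esub> Farr G (Farr F (Farr G f)) = ?h"
      using e2[OF h] gd(5)[OF e1[OF X] h] gd(5)[OF fd(2)[OF gf] e1[OF Y]] by simp
    have harr: "is_arr B ?h (Fob G (Fob F (Fob G ?X))) (Fob G ?Y)" using B.comp1_arr[OF ge gf] .
    then have hA: "?h \<in> Arr B" by (simp add: is_arr_def)
    have GX: "Fob G ?X \<in> Ob B" using X gd(1) by auto
    have m: "is_arr B (Farr G (\<epsilon> (Fob F (Fob G ?X)))) (Fob G (Fob F (Fob G (Fob F (Fob G ?X))))) (Fob G (Fob F (Fob G ?X)))"
      using e1 X fd(1) gd by auto
    have tg: "is_arr B (Farr G (Farr F (Farr G (\<epsilon> ?X)))) (Fob G (Fob F (Fob G (Fob F (Fob G ?X))))) (Fob G (Fob F (Fob G ?X)))"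
      using fd(2)[OF ge] gd(2) by auto
    have al1: "Farr G (\<epsilon> ?X) \<odot>\<^bsub>B\<^esub> Farr G (\<epsilon> (Fob F (Fob G ?X))) = Farr G (\<epsilon> ?X) \<odot>\<^bsub>B\<^esub> Farr G (Farr F (Farr G (\<epsilon> ?X)))"
       "Farr G (\<epsilon> ?X) \<odot>\<^bsub>B\<^esub> \<eta> (Fob G ?X) = Id1 B (Fob G ?X)"
      using al[OF X] by (auto simp: is_alg_def TF comparison_def Let_def)
    have Th: "Fcel G (Fcel F (Id2 B ?h)) = Id2 B (Farr G (Farr F ?h))"
      using fd(6)[OF hA] gd(6) fd(2)[OF harr] by (auto simp: is_arr_def)
    have Tharr: "is_arr B (Farr G (Farr F ?h)) (Fob G (Fob F (Fob G (Fob F (Fob G ?X))))) (Fob G (Fob F (Fob G ?Y)))"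
      using gd(2)[OF fd(2)[OF harr]] .
    have Th2: "Farr G (Farr F ?h) = Farr G (Farr F (Farr G f)) \<odot>\<^bsub>B\<^esub> Farr G (Farr F (Farr G (\<epsilon> ?X)))"
      using fd(5)[OF ge gf] gd(5)[OF fd(2)[OF ge] fd(2)[OF gf]] by simp
    have q: "?h \<odot>\<^bsub>B\<^esub> Farr G (\<epsilon> (Fob F (Fob G ?X))) = ?h \<odot>\<^bsub>B\<^esub> Farr G (Farr F (Farr G (\<epsilon> ?X)))"
      using B.comp1_assoc[OF m ge gf] B.comp1_assoc[OF tg ge gf] al1 by simp
    have q2: "Farr G (\<epsilon> ?Y) \<odot>\<^bsub>B\<^esub> Farr G (Farr F ?h) = ?h \<odot>\<^bsub>B\<^esub> Farr G (Farr F (Farr G (\<epsilon> ?X)))"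
      using Th2 B.comp1_assoc[OF tg gd(2)[OF fd(2)[OF gf]] gy] eq by simp
    have q3: "?h \<odot>\<^bsub>B\<^esub> \<eta> (Fob G ?X) = Farr G f" 
      using B.comp1_assoc[OF n1[OF GX] ge gf] al1 B.comp1_id_right[OF gf] by simp
    have arrh: "?h \<odot>\<^bsub>B\<^esub> Farr G (Farr F (Farr G (\<epsilon> ?X))) \<in> Arr B"
      using B.comp1_arr[OF tg harr] by (simp add: is_arr_def)
    show ?thesis 
      unfolding strict_mor_def lax_mor_def
      using al[OF X] al[OF Y] gf hA
      apply (simp add: comparison_def Let_def TF eq B.id2_cell Th)
      using B.hcomp_id2[OF m harr] B.hcomp_id2[OF tg harr] B.hcomp_id2[OF Tharr gy] B.hcomp_id2[OF n1[OF GX] harr]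
        B.vcomp_id_left[OF B.id2_cell[OF arrh]]
      apply (simp add: q q2 q3)
      done
  qed
  show "lax_cell B T (Fcel (comparison A B G \<epsilon>) \<alpha>)" if a: "\<alpha> \<in> Cel A" for \<alpha>
  proof -
    let ?f = "Dom A \<alpha>" and ?g = "Cod A \<alpha>"
    let ?X = "Src A ?f" and ?Y = "Trg A ?f"
    have f: "?f \<in> Arr A" "?g \<in> Arr A" using a A.dom_arr A.cod_arr by auto
    have h: "is_arr A ?f ?X ?Y" using f by (simp add: is_arr_def)
    have X: "?X \<in> Ob A" and Y: "?Y \<in> Ob A" using A.src_ob A.trg_ob f by auto
    have c: "is_cell A \<alpha> ?f ?g" using a by (simp add: is_cell_def)
    have s: "Src A ?g = ?X" "Trg A ?g = ?Y" using A.cell_src A.cell_trg a by auto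
    have g: "is_arr A ?g ?X ?Y" using f s by (simp add: is_arr_def)
    have iX: "is_cell A (Id2 A (\<epsilon> ?X)) (\<epsilon> ?X) (\<epsilon> ?X)" "is_cell A (Id2 A (\<epsilon> ?Y)) (\<epsilon> ?Y) (\<epsilon> ?Y)"
      using A.id2_cell e1 X Y by (auto simp: is_arr_def)
    have tt: "Trg A (\<epsilon> ?X) = Src A ?f" "Trg A (Farr F (Farr G ?f)) = Src A (\<epsilon> ?Y)"
      using e1 X Y fd(2)[OF gd(2)[OF h]] by (auto simp: is_arr_def)
    have id: "Fcel G (Id2 A (\<epsilon> ?X)) = Id2 B (Farr G (\<epsilon> ?X))" "Fcel G (Id2 A (\<epsilon> ?Y)) = Id2 B (Farr G (\<epsilon> ?Y))"
      using gd(6) e1 X Y by (auto simp: is_arr_def)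
    have eq: "Fcel G \<alpha> \<rhd>\<^bsub>B\<^esub> Farr G (\<epsilon> ?X) = Farr G (\<epsilon> ?Y) \<lhd>\<^bsub>B\<^esub> Fcel G (Fcel F (Fcel G \<alpha>))"
      using gd(8)[OF iX(1) c tt(1)] gd(8)[OF fd(3)[OF gd(3)[OF c]] iX(2) tt(2)] e3[OF h c] id by simp
    have k: "is_cell B (Fcel G \<alpha> \<rhd>\<^bsub>B\<^esub> Farr G (\<epsilon> ?X)) (Farr G ?f \<odot>\<^bsub>B\<^esub> Farr G (\<epsilon> ?X)) (Farr G ?g \<odot>\<^bsub>B\<^esub> Farr G (\<epsilon> ?X))"
      using gd(3)[OF iX(1)] gd(3)[OF c] id gd(2)[OF e1[OF X]] gd(2)[OF h]
      by (intro B.hcomp_cell) (auto simp: is_arr_def)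
    show ?thesis unfolding lax_cell_def alg_cell_between_def
      using gd(3)[OF c] B.vcomp_id_left[OF k] B.vcomp_id_right[OF k] eq
      by (simp add: comparison_def Let_def TF s)
  qed
qed

definition extension_over where
  "extension_over w A B T H E E' \<longleftrightarrow> F_functor A (F_T_Alg w B T) E' \<and>
     tight_part A (F_T_Alg w B T) E' E \<and> two_fun_eq (Loose A) (forget \<circ>\<^sub>2 E') H"

end

theory Submission
  imports Defs
begin

text \<open>
  Both composites send an object to its comparison algebra, and they lie over the same
  2-functor to the base; hence they can differ only in the structure 2-cell attached to a loose
  morphism \<open>f : X \<leadsto> Y\<close>. The pseudolimit of \<open>f\<close> pins that 2-cell down. It presents \<open>f\<close> by tight
  morphisms \<open>p : C \<rightarrow> X\<close> and \<open>q : C \<rightarrow> Y\<close> together with an invertible 2-cell \<open>\<Lambda> : q \<Rightarrow> f p\<close>. The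
  images of \<open>p\<close> and \<open>q\<close> are strict, so the condition that the image of \<open>\<Lambda>\<close> be an algebra 2-cell
  (lemmas \<open>lax_structure_via_strict_leg\<close> and \<open>colax_structure_via_strict_leg\<close>) reads, with \<open>\<phi>\<close>
  the structure 2-cell of \<open>f\<close> for lax (in particular pseudo) morphisms and \<open>\<psi>\<close> that for colax
  morphisms,
    \<open>(\<phi> Tp) \<circ> (b T\<Lambda>) = \<Lambda> c\<close>  and  \<open>(\<psi> Tp) \<circ> (\<Lambda> c) = b T\<Lambda>\<close>,
  where \<open>b\<close> and \<open>c\<close> are the actions on \<open>Y\<close> and \<open>C\<close>. As \<open>\<Lambda>\<close> is invertible, the whiskered 2-cell
  \<open>\<phi> Tp\<close> is determined by data that do not mention the extension, and \<open>\<psi> Tp\<close> is its inverse,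
  as it should be: a pseudo morphism becomes colax by inverting its structure 2-cell.

  It remains to cancel \<open>Tp\<close>. The identity 2-cell of \<open>f\<close> is a cone with first leg the identity
  of \<open>X\<close>, so it induces a section of \<open>p\<close> (lemma \<open>limit_projection_section\<close>). Therefore \<open>Tp\<close> is a
  split epimorphism, and whiskering with it is injective (lemma \<open>split_epi_cancel\<close>).
  Since the inclusion of loose into very loose morphisms is a 2-functor, it carries the whole
  presentation of \<open>f\<close> along, and the same computation applies to both extensions.
\<close>

section \<open>Invertible 2-cells and split epimorphisms\<close>

context two_category
begin

lemma is_arr_ob: "is_arr C f X Y \<Longrightarrow> X \<in> Ob C \<and> Y \<in> Ob C"
  using src_ob trg_ob by (auto simp: is_arr_def)

lemma is_cell_arr:
  assumes "is_cell C \<alpha> f g"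
  shows "is_arr C f (Src C f) (Trg C f)" and "is_arr C g (Src C f) (Trg C f)"
  using assms dom_arr[of \<alpha>] cod_arr[of \<alpha>] cell_src[of \<alpha>] cell_trg[of \<alpha>]
  by (auto simp: is_arr_def is_cell_def)

lemma inverse_cells_unique:
  assumes 1: "inverse_cells C \<alpha> \<beta>" and 2: "inverse_cells C \<alpha> \<gamma>"
  shows "\<beta> = \<gamma>"
proof -
  have a: "is_cell C \<alpha> (Dom C \<alpha>) (Cod C \<alpha>)" and b: "is_cell C \<beta> (Cod C \<alpha>) (Dom C \<alpha>)"
    and c: "is_cell C \<gamma> (Cod C \<alpha>) (Dom C \<alpha>)"
    using 1 2 by (auto simp: inverse_cells_def is_cell_def)
  have "\<beta> = (\<gamma> \<bullet> \<alpha>) \<bullet> \<beta>"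
    using vcomp_id_left[OF b] 2 by (simp add: inverse_cells_def)
  also have "\<dots> = \<gamma> \<bullet> (\<alpha> \<bullet> \<beta>)" by (rule vcomp_assoc[OF b a c])
  also have "\<dots> = \<gamma>" using vcomp_id_right[OF c] 1 by (simp add: inverse_cells_def)
  finally show ?thesis .
qed

lemma inv_cell_eq: "inverse_cells C \<alpha> \<beta> \<Longrightarrow> inv_cell C \<alpha> = \<beta>"
  unfolding inv_cell_def using inverse_cells_unique by blast

lemma id2_iso: "f \<in> Arr C \<Longrightarrow> Id2 C f \<in> iso_cells C"
  using id2_cell[of f] vcomp_id_right[of "Id2 C f" f f]
  by (auto simp: iso_cells_def inverse_cells_def is_cell_def)

lemma iso_cells_cancel:
  assumes iso: "\<gamma> \<in> iso_cells C" and g: "is_cell C \<gamma> f g"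
    and a: "is_cell C \<alpha> g h" and b: "is_cell C \<beta> g h" and eq: "\<alpha> \<bullet> \<gamma> = \<beta> \<bullet> \<gamma>"
  shows "\<alpha> = \<beta>"
proof -
  obtain \<delta> where d: "is_cell C \<delta> g f" and gd: "\<gamma> \<bullet> \<delta> = Id2 C g"
    using iso g by (auto simp: iso_cells_def inverse_cells_def is_cell_def)
  have "(\<alpha> \<bullet> \<gamma>) \<bullet> \<delta> = (\<beta> \<bullet> \<gamma>) \<bullet> \<delta>" using eq by simp
  then show ?thesis
    by (simp add: vcomp_assoc[OF d g a] vcomp_assoc[OF d g b] gd
        vcomp_id_right[OF a] vcomp_id_right[OF b])
qed

lemma whisker_left_cell:
  assumes "is_arr C h Y Z" and "is_cell C \<alpha> f g" and "Trg C f = Y"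
  shows "is_cell C (h \<lhd> \<alpha>) (h \<odot> f) (h \<odot> g)"
  using hcomp_cell[OF assms(2) id2_cell[of h]] assms by (simp add: is_arr_def)

lemma whisker_right_cell:
  assumes "is_arr C h X Y" and "is_cell C \<alpha> f g" and "Src C f = Y"
  shows "is_cell C (\<alpha> \<rhd> h) (f \<odot> h) (g \<odot> h)"
  using hcomp_cell[OF id2_cell[of h] assms(2)] assms by (simp add: is_arr_def)

lemma whisker_right_vcomp:
  assumes h: "is_arr C h X Y" and a: "is_cell C \<alpha> f g" and b: "is_cell C \<beta> g k"
    and s: "Src C f = Y"
  shows "(\<beta> \<bullet> \<alpha>) \<rhd> h = (\<beta> \<rhd> h) \<bullet> (\<alpha> \<rhd> h)"
proof -
  have i: "is_cell C (Id2 C h) h h" using id2_cell h by (simp add: is_arr_def)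
  show ?thesis
    using interchange[OF i i a b] vcomp_id_left[OF i] h s by (simp add: is_arr_def)
qed

lemma whisker_left_iso:
  assumes h: "is_arr C h Y Z" and iso: "\<gamma> \<in> iso_cells C" and c: "is_cell C \<gamma> f g"
    and t: "Trg C f = Y"
  shows "h \<lhd> \<gamma> \<in> iso_cells C"
proof -
  obtain \<delta> where d: "is_cell C \<delta> g f" and e: "\<delta> \<bullet> \<gamma> = Id2 C f" "\<gamma> \<bullet> \<delta> = Id2 C g"
    using iso c by (auto simp: iso_cells_def inverse_cells_def is_cell_def)
  have i: "is_cell C (Id2 C h) h h" using id2_cell h by (simp add: is_arr_def)
  note fa = is_cell_arr[OF c]
  have tf: "Trg C f = Src C h" "Trg C g = Src C h" using h t fa by (auto simp: is_arr_def)
  have hf: "is_arr C f (Src C f) Y" "is_arr C g (Src C f) Y" using fa t by auto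
  have "(h \<lhd> \<delta>) \<bullet> (h \<lhd> \<gamma>) = Id2 C (h \<odot> f)"
    using interchange[OF c d i i tf(1)] vcomp_id_left[OF i] e(1) hcomp_id2[OF hf(1) h] by simp
  moreover have "(h \<lhd> \<gamma>) \<bullet> (h \<lhd> \<delta>) = Id2 C (h \<odot> g)"
    using interchange[OF d c i i tf(2)] vcomp_id_left[OF i] e(2) hcomp_id2[OF hf(2) h] by simp
  moreover have "is_cell C (h \<lhd> \<gamma>) (h \<odot> f) (h \<odot> g)" "is_cell C (h \<lhd> \<delta>) (h \<odot> g) (h \<odot> f)"
    using hcomp_cell[OF c i tf(1)] hcomp_cell[OF d i tf(2)] by auto
  ultimately show ?thesis by (auto simp: iso_cells_def inverse_cells_def is_cell_def)
qed

text \<open>Whiskering further with the section \<open>t\<close> recovers the original 2-cell.\<close>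

lemma split_epi_cancel:
  assumes p: "is_arr C p Z X" and t: "is_arr C t X Z" and pt: "p \<odot> t = Id1 C X"
    and a: "is_cell C \<alpha> f g" and b: "is_cell C \<beta> f' g'" and s: "Src C f = X" "Src C f' = X"
    and eq: "\<alpha> \<rhd> p = \<beta> \<rhd> p"
  shows "\<alpha> = \<beta>"
proof -
  have i: "is_cell C (Id2 C p) p p" "is_cell C (Id2 C t) t t"
    using id2_cell p t by (auto simp: is_arr_def)
  have "(\<gamma> \<rhd> p) \<rhd> t = \<gamma>" if "is_cell C \<gamma> k k'" "Src C k = X" for \<gamma> k k'
    using hcomp_assoc[OF i(2) i(1) that(1)] hcomp_id2[OF t p] pt hcomp_id_right[OF that(1)] p t that
    by (simp add: is_arr_def)
  then show ?thesis using a b s eq by metis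
qed

text \<open>Cancel the invertible \<open>\<gamma>\<close> and then the split epimorphism \<open>p\<close>. For the structure 2-cell of a
  loose morphism, both come from its pseudolimit.\<close>

lemma cell_determined_on_presentation:
  assumes p: "is_arr C p Z X" and t: "is_arr C t X Z" and pt: "p \<odot> t = Id1 C X"
    and iso: "\<gamma> \<in> iso_cells C" and g: "is_cell C \<gamma> h (k \<odot> p)"
    and a: "is_cell C \<alpha> k l" and b: "is_cell C \<beta> k l" and s: "Src C k = X"
    and eq: "(\<alpha> \<rhd> p) \<bullet> \<gamma> = (\<beta> \<rhd> p) \<bullet> \<gamma>"
  shows "\<alpha> = \<beta>"
  using split_epi_cancel[OF p t pt a b s s]
    iso_cells_cancel[OF iso g whisker_right_cell[OF p a s] whisker_right_cell[OF p b s] eq]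
  by blast

text \<open>Evaluated on the presentation, \<open>\<psi> \<phi>\<close> agrees with an identity; the equation
  \<open>\<phi> \<psi> = 1\<close> then follows because \<open>\<phi>\<close> is invertible.\<close>

lemma inverse_cells_on_presentation:
  assumes p: "is_arr C p Z X" and t: "is_arr C t X Z" and pt: "p \<odot> t = Id1 C X"
    and iso: "\<gamma> \<in> iso_cells C" and g: "is_cell C \<gamma> h (k \<odot> p)"
    and a: "is_cell C \<phi> k l" and b: "is_cell C \<psi> l k" and s: "Src C k = X"
    and ai: "\<phi> \<in> iso_cells C"
    and 1: "(\<phi> \<rhd> p) \<bullet> \<gamma> = \<delta>" and 2: "(\<psi> \<rhd> p) \<bullet> \<delta> = \<gamma>"
  shows "inverse_cells C \<phi> \<psi>"
proof -
  note k = is_cell_arr[OF a] and l = is_cell_arr[OF b]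
  have sl: "Src C l = X" using k s by (simp add: is_arr_def)
  have kX: "is_arr C k X (Trg C k)" using k s by simp
  have i: "is_cell C (Id2 C k) k k" "is_cell C (Id2 C l) l l"
    using k id2_cell by (auto simp: is_arr_def)
  have ba: "is_cell C (\<psi> \<bullet> \<phi>) k k" and ab: "is_cell C (\<phi> \<bullet> \<psi>) l l"
    using vcomp_cell a b by auto
  have "((\<psi> \<bullet> \<phi>) \<rhd> p) \<bullet> \<gamma> = ((\<psi> \<rhd> p) \<bullet> (\<phi> \<rhd> p)) \<bullet> \<gamma>"
    using whisker_right_vcomp[OF p a b s] by simp
  also have "\<dots> = \<gamma>"
    using vcomp_assoc[OF g whisker_right_cell[OF p a s] whisker_right_cell[OF p b sl]] 1 2 by simp
  also have "\<dots> = (Id2 C k \<rhd> p) \<bullet> \<gamma>"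
    using hcomp_id2[OF p kX] vcomp_id_left[OF g] by simp
  finally have left: "\<psi> \<bullet> \<phi> = Id2 C k"
    by (rule cell_determined_on_presentation[OF p t pt iso g ba i(1) s])
  have "(\<phi> \<bullet> \<psi>) \<bullet> \<phi> = Id2 C l \<bullet> \<phi>"
    using vcomp_assoc[OF a b a] left vcomp_id_right[OF a] vcomp_id_left[OF a] by simp
  then have "\<phi> \<bullet> \<psi> = Id2 C l"
    by (rule iso_cells_cancel[OF ai a ab i(2)])
  with left show ?thesis using a b by (auto simp: inverse_cells_def is_cell_def)
qed

end

lemma two_functor_iso:
  assumes F: "two_functor A B F" and A: "two_category A" and iso: "\<alpha> \<in> iso_cells A"
  shows "Fcel F \<alpha> \<in> iso_cells B"
proof -
  interpret A: two_category A by fact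
  note fd = two_functorD[OF F]
  obtain \<beta> f g where a: "is_cell A \<alpha> f g" and b: "is_cell A \<beta> g f"
    and e: "\<beta> \<bullet>\<^bsub>A\<^esub> \<alpha> = Id2 A f" "\<alpha> \<bullet>\<^bsub>A\<^esub> \<beta> = Id2 A g"
    using iso by (auto simp: iso_cells_def inverse_cells_def is_cell_def)
  have "f \<in> Arr A" "g \<in> Arr A" using A.is_cell_arr[OF a] by (auto simp: is_arr_def)
  then have "Fcel F \<beta> \<bullet>\<^bsub>B\<^esub> Fcel F \<alpha> = Id2 B (Farr F f)"
    and "Fcel F \<alpha> \<bullet>\<^bsub>B\<^esub> Fcel F \<beta> = Id2 B (Farr F g)"
    using fd(7)[OF a b] fd(7)[OF b a] e fd(6) by auto
  then show ?thesis
    using fd(3)[OF a] fd(3)[OF b] by (auto simp: iso_cells_def inverse_cells_def is_cell_def)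
qed

section \<open>The limit projection is a split epimorphism\<close>

text \<open>The section is the morphism induced by the cone \<open>(1, 1\<^sub>f, f)\<close>.\<close>

lemma limit_projection_section:
  assumes L: "two_category (Loose A)" and lim: "limit_wrt A K f C p \<Lambda> q"
    and f: "is_arr (Loose A) f X Y" and K: "Id2 (Loose A) f \<in> K"
  obtains t where "is_arr (Loose A) t X C" and "p \<odot>\<^bsub>Loose A\<^esub> t = Id1 (Loose A) X"
proof -
  interpret L: two_category "Loose A" by fact
  have "cone (Loose A) K f X (Id1 (Loose A) X) (Id2 (Loose A) f) f"
    using f K L.id1_arr L.is_arr_ob[OF f] L.id2_cell L.comp1_id_right[OF f]
    by (auto simp: cone_def is_arr_def)
  then have "\<exists>t. induces (Loose A) C p \<Lambda> q X (Id1 (Loose A) X) (Id2 (Loose A) f) f t"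
    using lim unfolding limit_wrt_def Let_def by blast
  then show ?thesis using that by (auto simp: induces_def)
qed

text \<open>Pseudolimits make every loose morphism, up to an invertible 2-cell, a tight morphism composed
  with a section of a tight morphism: whiskering \<open>\<Lambda>\<close> with \<open>t\<close> gives \<open>q t \<cong> f p t = f\<close>.\<close>

lemma pseudo_limit_presentation:
  assumes L: "two_category (Loose A)" and lim: "admits_limits (bar Pseudo) A"
    and f: "is_arr (Loose A) f X Y"
  obtains C p q \<Lambda> t where "p \<in> tight_arrs A" "q \<in> tight_arrs A"
    "is_arr (Loose A) p C X" "is_arr (Loose A) q C Y"
    "is_cell (Loose A) \<Lambda> q (f \<odot>\<^bsub>Loose A\<^esub> p)" "\<Lambda> \<in> iso_cells (Loose A)"
    "is_arr (Loose A) t X C" "p \<odot>\<^bsub>Loose A\<^esub> t = Id1 (Loose A) X"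
proof -
  interpret L: two_category "Loose A" by fact
  obtain C p \<Lambda> q where lm: "limit_wrt A (iso_cells (Loose A)) f C p \<Lambda> q"
    using lim f by (auto simp: admits_limits_def pseudo_limit_def is_arr_def)
  obtain t where t: "is_arr (Loose A) t X C" "p \<odot>\<^bsub>Loose A\<^esub> t = Id1 (Loose A) X"
    using limit_projection_section[OF L lm f] L.id2_iso f by (auto simp: is_arr_def)
  have "p \<in> tight_arrs A" "q \<in> tight_arrs A" "cone (Loose A) (iso_cells (Loose A)) f C p \<Lambda> q"
    using lm by (auto simp: limit_wrt_def Let_def)
  then show ?thesis using that[of p q C \<Lambda> t] t f by (auto simp: cone_def is_arr_def)
qed

section \<open>Algebra 2-cells between composites with strict morphisms\<close>

text \<open>With \<open>q\<close> and \<open>m\<close> strict, their structure 2-cells drop out of the condition on an algebra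
  2-cell \<open>q \<Rightarrow> n m\<close>, which becomes an equation for the structure 2-cell of \<open>n\<close> alone.\<close>

lemma lax_structure_via_strict_leg:
  assumes B: "two_category B" and Tf: "two_functor B B (Fun T)"
    and cell: "lax_cell B T x" "cdom x = q" "ccod x = lax_comp B T n m"
    and n: "lax_mor B T n" and m: "lax_mor B T m" and q: "lax_mor B T q" and nm: "msrc n = mtrg m"
    and ms: "mcel m \<in> Id2 B ` Arr B" and qs: "mcel q \<in> Id2 B ` Arr B"
  shows "(mcel n \<rhd>\<^bsub>B\<^esub> Farr (Fun T) (mmap m)) \<bullet>\<^bsub>B\<^esub> (act (mtrg n) \<lhd>\<^bsub>B\<^esub> Fcel (Fun T) (ccel x)) =
    ccel x \<rhd>\<^bsub>B\<^esub> act (msrc m)"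
proof -
  interpret B: two_category B by fact
  note td = two_functorD[OF Tf]
  let ?a = "act (msrc m)" and ?b = "act (mtrg m)" and ?c = "act (mtrg n)"
  let ?Tm = "Farr (Fun T) (mmap m)" and ?Tn = "Farr (Fun T) (mmap n)"
  let ?M = "und (msrc m)" and ?N = "und (mtrg m)" and ?P = "und (mtrg n)"
  let ?T = "Fob (Fun T)"
  have sq: "msrc q = msrc m" "mtrg q = mtrg n"
    and xc: "is_cell B (ccel x) (mmap q) (mmap n \<odot>\<^bsub>B\<^esub> mmap m)"
    using cell by (auto simp: lax_cell_def alg_cell_between_def lax_comp_def Let_def)
  have eq: "(ccel x \<rhd>\<^bsub>B\<^esub> ?a) \<bullet>\<^bsub>B\<^esub> mcel q =
      ((mmap n \<lhd>\<^bsub>B\<^esub> mcel m) \<bullet>\<^bsub>B\<^esub> (mcel n \<rhd>\<^bsub>B\<^esub> ?Tm)) \<bullet>\<^bsub>B\<^esub> (?c \<lhd>\<^bsub>B\<^esub> Fcel (Fun T) (ccel x))"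
    using cell sq by (auto simp: lax_cell_def lax_comp_def Let_def)
  have a: "is_arr B ?a (?T ?M) ?M" and b: "is_arr B ?b (?T ?N) ?N" and c: "is_arr B ?c (?T ?P) ?P"
    and mm: "is_arr B (mmap m) ?M ?N" and nn: "is_arr B (mmap n) ?N ?P"
    and qq: "is_arr B (mmap q) ?M ?P"
    and mc: "is_cell B (mcel m) (?b \<odot>\<^bsub>B\<^esub> ?Tm) (mmap m \<odot>\<^bsub>B\<^esub> ?a)"
    and nc: "is_cell B (mcel n) (?c \<odot>\<^bsub>B\<^esub> ?Tn) (mmap n \<odot>\<^bsub>B\<^esub> ?b)"
    and qc: "is_cell B (mcel q) (?c \<odot>\<^bsub>B\<^esub> Farr (Fun T) (mmap q)) (mmap q \<odot>\<^bsub>B\<^esub> ?a)"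
    using n m q nm sq by (auto simp: lax_mor_def is_alg_def Let_def)
  note Tm = td(2)[OF mm] and Tn = td(2)[OF nn]
  have mi: "mcel m = Id2 B (?b \<odot>\<^bsub>B\<^esub> ?Tm)"
    using ms mc B.id2_cell by (auto simp: is_cell_def)
  have qi: "mcel q = Id2 B (mmap q \<odot>\<^bsub>B\<^esub> ?a)"
    using qs qc B.id2_cell by (auto simp: is_cell_def)
  have xa: "is_cell B (ccel x \<rhd>\<^bsub>B\<^esub> ?a) (mmap q \<odot>\<^bsub>B\<^esub> ?a) ((mmap n \<odot>\<^bsub>B\<^esub> mmap m) \<odot>\<^bsub>B\<^esub> ?a)"
    using B.whisker_right_cell[OF a xc] qq by (simp add: is_arr_def)
  have nT: "is_cell B (mcel n \<rhd>\<^bsub>B\<^esub> ?Tm) ((?c \<odot>\<^bsub>B\<^esub> ?Tn) \<odot>\<^bsub>B\<^esub> ?Tm) (mmap n \<odot>\<^bsub>B\<^esub> ?b \<odot>\<^bsub>B\<^esub> ?Tm)"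
    using B.whisker_right_cell[OF Tm nc] B.comp1_arr[OF Tn c] B.comp1_assoc[OF Tm b nn]
    by (simp add: is_arr_def)
  have "mmap n \<lhd>\<^bsub>B\<^esub> mcel m = Id2 B (mmap n \<odot>\<^bsub>B\<^esub> ?b \<odot>\<^bsub>B\<^esub> ?Tm)"
    using B.hcomp_id2[OF B.comp1_arr[OF Tm b] nn] mi by simp
  then show ?thesis
    using eq qi B.vcomp_id_right[OF xa] B.vcomp_id_left[OF nT] by simp
qed

text \<open>Structure 2-cells now point the other way, so the same two whiskerings of the underlying
  2-cell of \<open>x\<close> are related in the opposite direction.\<close>

lemma colax_structure_via_strict_leg:
  assumes B: "two_category B" and Tf: "two_functor B B (Fun T)"
    and cell: "colax_cell B T x" "cdom x = q" "ccod x = colax_comp B T n m"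
    and n: "colax_mor B T n" and m: "colax_mor B T m" and q: "colax_mor B T q"
    and nm: "msrc n = mtrg m"
    and ms: "mcel m \<in> Id2 B ` Arr B" and qs: "mcel q \<in> Id2 B ` Arr B"
  shows "(mcel n \<rhd>\<^bsub>B\<^esub> Farr (Fun T) (mmap m)) \<bullet>\<^bsub>B\<^esub> (ccel x \<rhd>\<^bsub>B\<^esub> act (msrc m)) =
    act (mtrg n) \<lhd>\<^bsub>B\<^esub> Fcel (Fun T) (ccel x)"
proof -
  interpret B: two_category B by fact
  note td = two_functorD[OF Tf]
  let ?a = "act (msrc m)" and ?b = "act (mtrg m)" and ?c = "act (mtrg n)"
  let ?Tm = "Farr (Fun T) (mmap m)" and ?Tn = "Farr (Fun T) (mmap n)"
  let ?M = "und (msrc m)" and ?N = "und (mtrg m)" and ?P = "und (mtrg n)"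
  let ?T = "Fob (Fun T)"
  have sq: "msrc q = msrc m" "mtrg q = mtrg n"
    and xc: "is_cell B (ccel x) (mmap q) (mmap n \<odot>\<^bsub>B\<^esub> mmap m)"
    using cell by (auto simp: colax_cell_def alg_cell_between_def colax_comp_def Let_def)
  have eq: "((mcel n \<rhd>\<^bsub>B\<^esub> ?Tm) \<bullet>\<^bsub>B\<^esub> (mmap n \<lhd>\<^bsub>B\<^esub> mcel m)) \<bullet>\<^bsub>B\<^esub> (ccel x \<rhd>\<^bsub>B\<^esub> ?a) =
      (?c \<lhd>\<^bsub>B\<^esub> Fcel (Fun T) (ccel x)) \<bullet>\<^bsub>B\<^esub> mcel q"
    using cell sq by (auto simp: colax_cell_def colax_comp_def Let_def)
  have a: "is_arr B ?a (?T ?M) ?M" and b: "is_arr B ?b (?T ?N) ?N" and c: "is_arr B ?c (?T ?P) ?P"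
    and mm: "is_arr B (mmap m) ?M ?N" and nn: "is_arr B (mmap n) ?N ?P"
    and qq: "is_arr B (mmap q) ?M ?P"
    and mc: "is_cell B (mcel m) (mmap m \<odot>\<^bsub>B\<^esub> ?a) (?b \<odot>\<^bsub>B\<^esub> ?Tm)"
    and nc: "is_cell B (mcel n) (mmap n \<odot>\<^bsub>B\<^esub> ?b) (?c \<odot>\<^bsub>B\<^esub> ?Tn)"
    and qc: "is_cell B (mcel q) (mmap q \<odot>\<^bsub>B\<^esub> ?a) (?c \<odot>\<^bsub>B\<^esub> Farr (Fun T) (mmap q))"
    using n m q nm sq by (auto simp: colax_mor_def is_alg_def Let_def)
  note Tm = td(2)[OF mm] and Tq = td(2)[OF qq]
  have mi: "mcel m = Id2 B (?b \<odot>\<^bsub>B\<^esub> ?Tm)"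
    using ms mc B.id2_cell by (auto simp: is_cell_def)
  have qi: "mcel q = Id2 B (?c \<odot>\<^bsub>B\<^esub> Farr (Fun T) (mmap q))"
    using qs qc B.id2_cell by (auto simp: is_cell_def)
  have Tx: "is_cell B (?c \<lhd>\<^bsub>B\<^esub> Fcel (Fun T) (ccel x)) (?c \<odot>\<^bsub>B\<^esub> Farr (Fun T) (mmap q))
      (?c \<odot>\<^bsub>B\<^esub> Farr (Fun T) (mmap n \<odot>\<^bsub>B\<^esub> mmap m))"
    using B.whisker_left_cell[OF c td(3)[OF xc]] Tq by (simp add: is_arr_def)
  have nT: "is_cell B (mcel n \<rhd>\<^bsub>B\<^esub> ?Tm) (mmap n \<odot>\<^bsub>B\<^esub> ?b \<odot>\<^bsub>B\<^esub> ?Tm) ((?c \<odot>\<^bsub>B\<^esub> ?Tn) \<odot>\<^bsub>B\<^esub> ?Tm)"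
    using B.whisker_right_cell[OF Tm nc] B.comp1_arr[OF b nn] B.comp1_assoc[OF Tm b nn]
    by (simp add: is_arr_def)
  have "mmap n \<lhd>\<^bsub>B\<^esub> mcel m = Id2 B (mmap n \<odot>\<^bsub>B\<^esub> ?b \<odot>\<^bsub>B\<^esub> ?Tm)"
    using B.hcomp_id2[OF B.comp1_arr[OF Tm b] nn] mi by simp
  then show ?thesis
    using eq qi B.vcomp_id_right[OF Tx] B.vcomp_id_right[OF nT] by simp
qed

section \<open>Structure 2-cells of presented morphisms\<close>

lemma is_arr_lax_AlgD:
  assumes "w \<in> {Pseudo, Lax}" and "is_arr (T_Alg w B T) m x y"
  shows "lax_mor B T m" and "msrc m = x" and "mtrg m = y"
  using assms by (auto simp: is_arr_def alg_two_cat_def pseudo_mor_def)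

lemma is_arr_colax_AlgD:
  assumes "is_arr (T_Alg Colax B T) m x y"
  shows "colax_mor B T m" and "msrc m = x" and "mtrg m = y"
  using assms by (auto simp: is_arr_def alg_two_cat_def)

text \<open>Applied to two 2-functors over the same base that agree on objects, the equation has the same
  right-hand side and the same invertible 2-cell on the left, so it compares their values at \<open>f\<close>.\<close>

lemma lax_Alg_structure:
  assumes B: "two_category B" and Tf: "two_functor B B (Fun T)" and w: "w \<in> {Pseudo, Lax}"
    and G: "two_functor L (T_Alg w B T) G"
    and f: "is_arr L f X Y" and p: "is_arr L p C X" and q: "is_arr L q C Y"
    and \<Lambda>: "is_cell L \<Lambda> q (f \<odot>\<^bsub>L\<^esub> p)"
    and ps: "mcel (Farr G p) \<in> Id2 B ` Arr B" and qs: "mcel (Farr G q) \<in> Id2 B ` Arr B"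
  shows "(mcel (Farr G f) \<rhd>\<^bsub>B\<^esub> Farr (Fun T) (mmap (Farr G p))) \<bullet>\<^bsub>B\<^esub>
      (act (Fob G Y) \<lhd>\<^bsub>B\<^esub> Fcel (Fun T) (ccel (Fcel G \<Lambda>))) =
    ccel (Fcel G \<Lambda>) \<rhd>\<^bsub>B\<^esub> act (Fob G C)"
proof -
  note gd = two_functorD[OF G]
  note F = is_arr_lax_AlgD[OF w gd(2)[OF f]] and P = is_arr_lax_AlgD[OF w gd(2)[OF p]]
    and Q = is_arr_lax_AlgD[OF w gd(2)[OF q]]
  have "lax_cell B T (Fcel G \<Lambda>)" "cdom (Fcel G \<Lambda>) = Farr G q"
    "ccod (Fcel G \<Lambda>) = lax_comp B T (Farr G f) (Farr G p)"
    using gd(3)[OF \<Lambda>] gd(5)[OF p f] w by (auto simp: is_cell_def alg_two_cat_def)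
  from lax_structure_via_strict_leg[OF B Tf this F(1) P(1) Q(1) _ ps qs] F P
  show ?thesis by simp
qed

lemma colax_Alg_structure:
  assumes B: "two_category B" and Tf: "two_functor B B (Fun T)"
    and G: "two_functor L (T_Alg Colax B T) G"
    and f: "is_arr L f X Y" and p: "is_arr L p C X" and q: "is_arr L q C Y"
    and \<Lambda>: "is_cell L \<Lambda> q (f \<odot>\<^bsub>L\<^esub> p)"
    and ps: "mcel (Farr G p) \<in> Id2 B ` Arr B" and qs: "mcel (Farr G q) \<in> Id2 B ` Arr B"
  shows "(mcel (Farr G f) \<rhd>\<^bsub>B\<^esub> Farr (Fun T) (mmap (Farr G p))) \<bullet>\<^bsub>B\<^esub>
      (ccel (Fcel G \<Lambda>) \<rhd>\<^bsub>B\<^esub> act (Fob G C)) =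
    act (Fob G Y) \<lhd>\<^bsub>B\<^esub> Fcel (Fun T) (ccel (Fcel G \<Lambda>))"
proof -
  note gd = two_functorD[OF G]
  note F = is_arr_colax_AlgD[OF gd(2)[OF f]] and P = is_arr_colax_AlgD[OF gd(2)[OF p]]
    and Q = is_arr_colax_AlgD[OF gd(2)[OF q]]
  have "colax_cell B T (Fcel G \<Lambda>)" "cdom (Fcel G \<Lambda>) = Farr G q"
    "ccod (Fcel G \<Lambda>) = colax_comp B T (Farr G f) (Farr G p)"
    using gd(3)[OF \<Lambda>] gd(5)[OF p f] by (auto simp: is_cell_def alg_two_cat_def)
  from colax_structure_via_strict_leg[OF B Tf this F(1) P(1) Q(1) _ ps qs] F P
  show ?thesis by simp
qed

section \<open>Extensions of the comparison\<close>

lemma extension_overD: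
  assumes "extension_over w A B T H E E'"
  shows "two_functor (Loose A) (T_Alg w B T) E'"
    and "f \<in> Arr (Loose A) \<Longrightarrow> mmap (Farr E' f) = Farr H f"
    and "\<alpha> \<in> Cel (Loose A) \<Longrightarrow> ccel (Fcel E' \<alpha>) = Fcel H \<alpha>"
    and "X \<in> Ob (Tight A) \<Longrightarrow> Fob E' (Fob (Incl A) X) = Fob E X"
    and "X \<in> Ob (Loose A) \<Longrightarrow> und (Fob E' X) = Fob H X"
  using assms
  by (auto simp: extension_over_def F_functor_def tight_part_def two_fun_eq_def two_fun_comp_def
      forget_def F_T_Alg_def two_fun_id_def)

lemma extension_over_tight_strict:
  assumes "extension_over w A B T H E E'" and "f \<in> tight_arrs A"
  shows "strict_mor B T (Farr E' f)"
proof -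
  obtain g where g: "g \<in> Arr (Tight A)" "f = Farr (Incl A) g"
    using assms(2) by (auto simp: tight_arrs_def)
  have E: "two_functor (Tight A) (T_Alg_s B T) E" and eq: "Farr E' f = Farr E g"
    using assms(1) g
    by (auto simp: extension_over_def tight_part_def F_T_Alg_def two_fun_eq_def two_fun_comp_def
        two_fun_id_def)
  have "Farr E g \<in> Arr (T_Alg_s B T)"
    using two_functorD(2)[OF E, of g "Src (Tight A) g" "Trg (Tight A) g"] g
    by (auto simp: is_arr_def)
  then show ?thesis using eq by (simp add: T_Alg_s_def alg_two_cat_def)
qed

theorem theorem24:
  fixes A :: "('o, 'm1, 'c1, 'm2, 'c2, 'm3, 'c3) F2_cat"
    and B :: "('p, 'n, 'd) two_cat"
    and Hl :: "('o, 'm2, 'c2, 'p, 'n, 'd) two_fun"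
    and Hv :: "('o, 'm3, 'c3, 'p, 'n, 'd) two_fun"
    and H :: "('o, 'm1, 'c1, 'p, 'n, 'd) two_fun"
    and F :: "('p, 'n, 'd, 'o, 'm1, 'c1) two_fun"
    and \<eta> :: "'p \<Rightarrow> 'n" and \<epsilon> :: "'o \<Rightarrow> 'm1"
    and T :: "('p, 'n, 'd) two_mnd"
    and E :: "('o, 'm1, 'c1, ('p, 'n) alg, ('p, 'n, 'd) alg_mor, ('p, 'n, 'd) alg_cel) two_fun"
    and Ep :: "('o, 'm2, 'c2, ('p, 'n) alg, ('p, 'n, 'd) alg_mor, ('p, 'n, 'd) alg_cel) two_fun"
    and Ew :: "('o, 'm3, 'c3, ('p, 'n) alg, ('p, 'n, 'd) alg_mor, ('p, 'n, 'd) alg_cel) two_fun"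
    and w :: flavour
  assumes w: "w \<in> {Lax, Colax}"
    and A: "F2_category A"
    and B: "two_category B"
    and Hl: "F_functor (F_tl A) (all_tight B) Hl"
    and Hv: "F_functor (F_tv A) (all_tight B) Hv"
    and triangle: "two_fun_eq (LooseP A) Hl (Hv \<circ>\<^sub>2 InclLV A)"
    and Hl_tight: "tight_part (F_tl A) (all_tight B) Hl H"
    and Hv_tight: "tight_part (F_tv A) (all_tight B) Hv H"
    and adj: "two_adjunction B (TightP A) F H \<eta> \<epsilon>"
    and T: "T = induced_monad F H \<eta> \<epsilon>"
    and E: "E = comparison (TightP A) B H \<epsilon>"
    and lim_p: "admits_limits (bar Pseudo) (F_tl A)"
    and lim_w: "admits_limits (bar w) (F_tv A)"
    and Ep: "extension_over Pseudo (F_tl A) B T Hl E Ep"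
    and Ew: "extension_over w (F_tv A) B T Hv E Ew"
  shows "two_fun_eq (LooseP A) (Ew \<circ>\<^sub>2 InclLV A) (pseudo_incl w B \<circ>\<^sub>2 Ep)"
proof -
  let ?L = "LooseP A" and ?V = "VeryLooseP A" and ?j = "InclLV A"
  let ?G = "Ew \<circ>\<^sub>2 ?j"
  have L: "two_category ?L" and At: "two_category (TightP A)"
    and jtl: "F_inclusion (TightP A) ?L (InclTL A)" and jlv: "F_inclusion ?L ?V ?j"
    using A by (auto simp: F2_category_def)
  interpret B: two_category B by (rule B)
  interpret L: two_category ?L by (rule L)
  have Tf: "two_functor B B (Fun T)"
    using induced_two_monad[OF B At adj] T by (simp add: two_monad_def)
  note td = two_functorD[OF Tf]
  have j: "two_functor ?L ?V ?j" using jlv by (simp add: F_inclusion_def)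
  note jd = two_functorD[OF j]
  have Hl2: "two_functor ?L B Hl" using Hl by (simp add: F_functor_def F_tl_def all_tight_def)
  note hd = two_functorD[OF Hl2]
  have tl: "Loose (F_tl A) = ?L" "Tight (F_tl A) = TightP A" "Incl (F_tl A) = InclTL A"
    and tv: "Loose (F_tv A) = ?V" "Tight (F_tv A) = TightP A" "Incl (F_tv A) = ?j \<circ>\<^sub>2 InclTL A"
    by (auto simp: F_tl_def F_tv_def)
  note epd = extension_overD[OF Ep, unfolded tl] and ewd = extension_overD[OF Ew, unfolded tv]
  have G: "two_functor ?L (T_Alg w B T) ?G" by (rule two_functor_comp[OF j ewd(1) L])
  note gd = two_functorD[OF G] and pd = two_functorD[OF epd(1)]

  have tri: "Farr Hv (Farr ?j f) = Farr Hl f" if "f \<in> Arr ?L" for f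
    using triangle that by (auto simp: two_fun_eq_def two_fun_comp_def)
  have tri2: "Fcel Hv (Fcel ?j \<alpha>) = Fcel Hl \<alpha>" if "\<alpha> \<in> Cel ?L" for \<alpha>
    using triangle that by (auto simp: two_fun_eq_def two_fun_comp_def)
  have jA: "Farr ?j f \<in> Arr ?V" if "f \<in> Arr ?L" for f
    using jd(2)[of f "Src ?L f" "Trg ?L f"] that by (auto simp: is_arr_def)
  have jC: "Fcel ?j \<alpha> \<in> Cel ?V" if "\<alpha> \<in> Cel ?L" for \<alpha>
    using jd(3)[of \<alpha> "Dom ?L \<alpha>" "Cod ?L \<alpha>"] that by (auto simp: is_cell_def)
  have Gm: "mmap (Farr ?G f) = Farr Hl f" if "f \<in> Arr ?L" for f
    using ewd(2)[OF jA] tri that by (simp add: two_fun_comp_def)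
  have Gc: "ccel (Fcel ?G \<alpha>) = Fcel Hl \<alpha>" if "\<alpha> \<in> Cel ?L" for \<alpha>
    using ewd(3)[OF jC] tri2 that by (simp add: two_fun_comp_def)
  have ob: "Fob ?G X = Fob Ep X" if "X \<in> Ob ?L" for X
    using that jtl jlv epd(4)[of X] ewd(4)[of X] by (simp add: F_inclusion_def two_fun_comp_def)
  have undEp: "und (Fob Ep X) = Fob Hl X" if "X \<in> Ob ?L" for X using epd(5) that by simp

  have tightG: "strict_mor B T (Farr ?G f)" if "f \<in> tight_arrs (F_tl A)" for f
    using extension_over_tight_strict[OF Ew, of "Farr ?j f"] that
    by (auto simp: tight_arrs_def tl tv two_fun_comp_def)
  note tightE = extension_over_tight_strict[OF Ep]

  have main: "Farr ?G f = Farr (pseudo_incl w B) (Farr Ep f)" if fA: "f \<in> Arr ?L" for f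
  proof -
    obtain X Y where f: "is_arr ?L f X Y" using fA by (auto simp: is_arr_def)
    obtain C p q \<Lambda> t where pT: "p \<in> tight_arrs (F_tl A)" and qT: "q \<in> tight_arrs (F_tl A)"
      and p: "is_arr ?L p C X" and q: "is_arr ?L q C Y"
      and \<Lambda>: "is_cell ?L \<Lambda> q (f \<odot>\<^bsub>?L\<^esub> p)" and \<Lambda>i: "\<Lambda> \<in> iso_cells ?L"
      and t: "is_arr ?L t X C" and pt: "p \<odot>\<^bsub>?L\<^esub> t = Id1 ?L X"
      using pseudo_limit_presentation[of "F_tl A" f X Y] L lim_p f unfolding tl by metis
    have obs: "X \<in> Ob ?L" "Y \<in> Ob ?L" "C \<in> Ob ?L" using L.is_arr_ob f p by auto
    have arrs: "p \<in> Arr ?L" "q \<in> Arr ?L" "\<Lambda> \<in> Cel ?L"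
      using p q \<Lambda> by (auto simp: is_arr_def is_cell_def)
    \<comment> \<open>The triangle over the base fixes the underlying 1-cells, so only the comparison of \<open>?\<phi>\<close>
      with \<open>?\<psi>\<close> is at stake; \<open>?\<gamma>\<close> is the invertible 2-cell cancelled together with \<open>?T p\<close>.\<close>
    let ?b = "act (Fob Ep Y)" and ?a = "act (Fob Ep X)" and ?c = "act (Fob Ep C)"
    let ?T = "\<lambda>f. Farr (Fun T) (Farr Hl f)"
    let ?\<phi> = "mcel (Farr Ep f)" and ?\<psi> = "mcel (Farr ?G f)"
    let ?\<gamma> = "?b \<lhd>\<^bsub>B\<^esub> Fcel (Fun T) (Fcel Hl \<Lambda>)"
    let ?k = "?b \<odot>\<^bsub>B\<^esub> ?T f" and ?l = "Farr Hl f \<odot>\<^bsub>B\<^esub> ?a"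
    note Pf = is_arr_lax_AlgD[OF _ pd(2)[OF f], simplified]
    have b: "is_arr B ?b (Fob (Fun T) (Fob Hl Y)) (Fob Hl Y)"
      and \<phi>: "is_cell B ?\<phi> ?k ?l"
      using Pf epd(2)[OF fA] undEp obs by (auto simp: lax_mor_def is_alg_def Let_def)
    have \<phi>i: "?\<phi> \<in> iso_cells B"
      using pd(2)[OF f] by (auto simp: is_arr_def alg_two_cat_def pseudo_mor_def)
    have Tp: "is_arr B (?T p) (Fob (Fun T) (Fob Hl C)) (Fob (Fun T) (Fob Hl X))"
      and Tt: "is_arr B (?T t) (Fob (Fun T) (Fob Hl X)) (Fob (Fun T) (Fob Hl C))"
      and Tff: "is_arr B (?T f) (Fob (Fun T) (Fob Hl X)) (Fob (Fun T) (Fob Hl Y))"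
      using td(2) hd(2) p t f by auto
    have Tpt: "?T p \<odot>\<^bsub>B\<^esub> ?T t = Id1 B (Fob (Fun T) (Fob Hl X))"
      using td(5)[OF hd(2)[OF t] hd(2)[OF p]] hd(5)[OF t p] pt hd(4)[OF obs(1)]
        td(4)[OF hd(1)[OF obs(1)]] by simp
    have Hq: "is_arr B (?T q) (Fob (Fun T) (Fob Hl C)) (Fob (Fun T) (Fob Hl Y))"
      using td(2)[OF hd(2)[OF q]] .
    have T\<Lambda>: "is_cell B (Fcel (Fun T) (Fcel Hl \<Lambda>)) (?T q) (?T f \<odot>\<^bsub>B\<^esub> ?T p)"
      using td(3)[OF hd(3)[OF \<Lambda>]] hd(5)[OF p f] td(5)[OF hd(2)[OF p] hd(2)[OF f]] by simp
    have T\<Lambda>i: "Fcel (Fun T) (Fcel Hl \<Lambda>) \<in> iso_cells B"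
      using two_functor_iso[OF Tf B two_functor_iso[OF Hl2 L \<Lambda>i]] .
    have trq: "Trg B (?T q) = Fob (Fun T) (Fob Hl Y)" using Hq by (simp add: is_arr_def)
    have \<gamma>: "is_cell B ?\<gamma> (?b \<odot>\<^bsub>B\<^esub> ?T q) (?k \<odot>\<^bsub>B\<^esub> ?T p)"
      using B.whisker_left_cell[OF b T\<Lambda> trq] B.comp1_assoc[OF Tp Tff b] by simp
    have \<gamma>i: "?\<gamma> \<in> iso_cells B" by (rule B.whisker_left_iso[OF b T\<Lambda>i T\<Lambda> trq])
    have sk: "Src B ?k = Fob (Fun T) (Fob Hl X)"
      using B.comp1_arr[OF Tff b] by (simp add: is_arr_def)
    have eqE: "(?\<phi> \<rhd>\<^bsub>B\<^esub> ?T p) \<bullet>\<^bsub>B\<^esub> ?\<gamma> = Fcel Hl \<Lambda> \<rhd>\<^bsub>B\<^esub> ?c"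
      using lax_Alg_structure[OF B Tf _ epd(1) f p q \<Lambda>] tightE[OF pT] tightE[OF qT]
        epd(2,3) arrs by (simp add: strict_mor_def)
    have sG: "mcel (Farr ?G p) \<in> Id2 B ` Arr B" "mcel (Farr ?G q) \<in> Id2 B ` Arr B"
      using tightG pT qT by (auto simp: strict_mor_def)
    have "w = Lax \<or> w = Colax" using w by auto
    then show ?thesis
    proof
      assume wL: "w = Lax"
      note Gf = is_arr_lax_AlgD[OF _ gd(2)[OF f], unfolded wL, simplified]
      have \<psi>: "is_cell B ?\<psi> ?k ?l"
        using Gf Gm[OF fA] ob obs by (auto simp: lax_mor_def Let_def)
      have "(?\<psi> \<rhd>\<^bsub>B\<^esub> ?T p) \<bullet>\<^bsub>B\<^esub> ?\<gamma> = Fcel Hl \<Lambda> \<rhd>\<^bsub>B\<^esub> ?c"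
        using lax_Alg_structure[OF B Tf _ G f p q \<Lambda> sG] wL Gm Gc ob obs arrs by simp
      then have "?\<psi> = ?\<phi>"
        using B.cell_determined_on_presentation[OF Tp Tt Tpt \<gamma>i \<gamma> \<psi> \<phi> sk] eqE by simp
      then show ?thesis
        using Gf Pf Gm[OF fA] epd(2)[OF fA] ob obs wL
        by (simp add: two_fun_id_def alg_mor.expand)
    next
      assume wC: "w = Colax"
      note Gf = is_arr_colax_AlgD[OF gd(2)[OF f, unfolded wC]]
      have \<psi>: "is_cell B ?\<psi> ?l ?k"
        using Gf Gm[OF fA] ob obs by (auto simp: colax_mor_def Let_def)
      have "(?\<psi> \<rhd>\<^bsub>B\<^esub> ?T p) \<bullet>\<^bsub>B\<^esub> (Fcel Hl \<Lambda> \<rhd>\<^bsub>B\<^esub> ?c) = ?\<gamma>"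
        using colax_Alg_structure[OF B Tf G[unfolded wC] f p q \<Lambda> sG] Gm Gc ob obs arrs by simp
      then have "inv_cell B ?\<phi> = ?\<psi>"
        using B.inverse_cells_on_presentation[OF Tp Tt Tpt \<gamma>i \<gamma> \<phi> \<psi> sk \<phi>i eqE] B.inv_cell_eq
        by simp
      then show ?thesis
        using Gf Pf Gm[OF fA] epd(2)[OF fA] ob obs wC
        by (simp add: inv_mor_def alg_mor.expand)
    qed
  qed

  have cells: "Fcel ?G \<alpha> = Fcel (pseudo_incl w B) (Fcel Ep \<alpha>)" if \<alpha>: "\<alpha> \<in> Cel ?L" for \<alpha>
  proof -
    have c: "is_cell ?L \<alpha> (Dom ?L \<alpha>) (Cod ?L \<alpha>)" using \<alpha> by (simp add: is_cell_def)
    note d = L.dom_arr[OF \<alpha>] L.cod_arr[OF \<alpha>]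
    show ?thesis
      using gd(3)[OF c] pd(3)[OF c] main[OF d(1)] main[OF d(2)] Gc[OF \<alpha>] epd(3)[OF \<alpha>] w
      by (auto simp: is_cell_def alg_two_cat_def two_fun_id_def intro!: alg_cel.expand)
  qed
  have obj: "Fob (pseudo_incl w B) X = X" for X
    using w by (auto simp: two_fun_id_def)
  show ?thesis
    using ob main cells obj by (simp add: two_fun_eq_def two_fun_comp_def)
qed

end
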